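(* Let $X\in\{F,L\}$, with $M_N^X$, $\kappa_N^X$, $D_X$ as defined in the context. Let $c_F=1/\sqrt5$, $c_L=1$, $\alpha=\frac{1+\sqrt5}{2}$ and $r=\alpha^2$. As $N$ tends to infinity through even integers, $$M_N^X\sim\frac{N!}{\pi^N}D_X,\qquad \kappa_N^X\sim\frac{2rD_X}{c_X}\,\frac{(N-1)!}{(\pi r)^N},$$ and moreover $$\kappa_N^X=\frac{2rD_X}{c_X}\,\frac{N!}{(N-r)(\pi r)^N}\left[1+O(\alpha^{-N})\right],$$ where the constants implicit in the last estimate depend only on $X$.
   Context: $\zeta$ denotes the Riemann zeta function (meromorphically continued). The Fibonacci and Lucas numbers are $F_0=0$, $F_1=1$, $L_0=2$, $L_1=1$, with $F_{j+2}=F_{j+1}+F_j$ and $L_{j+2}=L_{j+1}+L_j$. The weights are $$a_j^F=F_j+F_{2j},\qquad a_j^L=L_{2j}-L_j\qquad(j\ge 0).$$ For $X\in\{F,L\}$ set $$E_X(t)=\sum_{j\ge 2,\ j\text{ even}}a_j^X\frac{t^j}{j!},\qquad D_X=E_X(\pi).$$ For an even integer $N\ge 4$ set $$t_{N,j}^X=N\binom{N-1}{j}a_j^X\,2^{N-j-1}\zeta(j+1-N)\quad(1\le j\le N-2),\qquad M_N^X=\sum_{j=1}^{N-2}|t_{N,j}^X|,$$ $$C_N^X=\frac{a_N^X-N a_{N-1}^X}{2},\qquad \kappa_N^X=\frac{M_N^X}{|C_N^X|}$$ (one has $C_N^X<0$ for every even $N\ge 4$, so $\kappa_N^X$ is well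 defined). The notation $u_N\sim v_N$ means $u_N/v_N\to 1$, and $O(\alpha^{-N})$ denotes a quantity bounded in absolute value by a constant times $\alpha^{-N}$ for all sufficiently large even $N$. *)

theory Defs
  imports
    "HOL-Complex_Analysis.Complex_Analysis"
    "HOL-Number_Theory.Fib"
    "HOL-Library.Landau_Symbols"
begin

text \<open>
  The meromorphic continuation is pinned down as a total function by requiring it to be nicely
  meromorphic: continuous wherever it has no pole, with value 0 at a pole (here only at 1).
  By the lemmas below there is at most one such function.
\<close>

definition is_zeta_continuation :: "(complex \<Rightarrow> complex) \<Rightarrow> bool" where
  "is_zeta_continuation f \<longleftrightarrow>
     f nicely_meromorphic_on UNIV \<and>
     (\<forall>s. Re s > 1 \<longrightarrow> (\<lambda>n. 1 / of_nat (Suc n) powr s) sums f s)"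

definition zeta :: "complex \<Rightarrow> complex" where
  "zeta = (THE f. is_zeta_continuation f)"

lemma is_zeta_continuation_unique:
  assumes f: "is_zeta_continuation f" and g: "is_zeta_continuation g"
  shows "f = g"
proof
  fix z
  define h where "h = (\<lambda>w. f w - g w)"
  have nf: "f nicely_meromorphic_on UNIV" and ng: "g nicely_meromorphic_on UNIV"
    using f g by (auto simp: is_zeta_continuation_def)
  have mh: "h meromorphic_on UNIV"
    unfolding h_def using nf ng
    by (auto simp: nicely_meromorphic_on_def intro!: meromorphic_intros)
  have rh: "remove_sings h nicely_meromorphic_on UNIV"
    using mh by (rule remove_sings_nicely_meromorphic)
  have h0: "h w = 0" if "Re w > 1" for w
    using f g that unfolding h_def is_zeta_continuation_def
    by (metis right_minus_eq sums_unique2)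
  have op: "open {w. Re w > 1}"
    by (rule open_halfspace_Re_gt)
  have r0: "remove_sings h w = 0" if "Re w > 1" for w
  proof (rule remove_sings_eqI)
    have "eventually (\<lambda>x. x \<in> {w. Re w > 1}) (nhds w)"
      using op that by (intro eventually_nhds_in_open) auto
    hence "eventually (\<lambda>x. h x = 0) (at w)"
      unfolding eventually_at_filter by eventually_elim (auto simp: h0)
    thus "h \<midarrow>w\<rightarrow> 0" by (rule tendsto_eventually)
  qed
  have "eventually (\<lambda>x. x \<in> {w. Re w > 1}) (at (2::complex))"
    using op by (intro eventually_at_in_open') auto
  hence "eventually (\<lambda>x. remove_sings h x = 0) (at (2::complex))"
    by eventually_elim (auto simp: r0)
  hence "frequently (\<lambda>x. remove_sings h x = 0) (at (2::complex))"
    by (intro eventually_frequently) auto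
  hence all0: "remove_sings h w = 0" for w
    using frequently_eq_meromorphic_imp_constant[OF _ rh, of 0 2] by auto
  have "eventually (\<lambda>w. remove_sings h w = h w) (at z)"
    using meromorphic_on_subset[OF mh, of "{z}"]
    by (intro eventually_remove_sings_eq_at) (simp add: meromorphic_at_iff)
  hence ev: "eventually (\<lambda>w. f w = g w) (at z)"
    by eventually_elim (metis all0 h_def right_minus_eq)
  have "remove_sings f z = remove_sings g z"
    using ev by (intro remove_sings_cong) auto
  moreover have "remove_sings k z = k z" if "k nicely_meromorphic_on UNIV" for k
    using that unfolding nicely_meromorphic_on_def
    by (metis UNIV_I remove_sings_at_pole remove_sings_eqI)
  ultimately show "f z = g z" using nf ng by simp
qed

lemma zeta_eqI: "is_zeta_continuation f \<Longrightarrow> zeta = f"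
  unfolding zeta_def using is_zeta_continuation_unique by blast

fun lucas :: "nat \<Rightarrow> nat" where
  "lucas 0 = 2"
| "lucas (Suc 0) = 1"
| "lucas (Suc (Suc n)) = lucas (Suc n) + lucas n"

datatype seq_kind = Fibonacci | Lucas

fun a_X :: "seq_kind \<Rightarrow> nat \<Rightarrow> real" where
  "a_X Fibonacci j = real (fib j) + real (fib (2 * j))"
| "a_X Lucas j = real (lucas (2 * j)) - real (lucas j)"

definition E_X :: "seq_kind \<Rightarrow> real \<Rightarrow> real" where
  "E_X X t = (\<Sum>\<^sub>\<infinity>j | 2 \<le> j \<and> even j. a_X X j * t ^ j / fact j)"

definition D_X :: "seq_kind \<Rightarrow> real" where
  "D_X X = E_X X pi"

definition t_X :: "seq_kind \<Rightarrow> nat \<Rightarrow> nat \<Rightarrow> complex" where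
  "t_X X N j = of_nat N * of_nat ((N - 1) choose j) * of_real (a_X X j)
     * 2 ^ (N - j - 1) * zeta (of_nat j + 1 - of_nat N)"

definition M_X :: "seq_kind \<Rightarrow> nat \<Rightarrow> real" where
  "M_X X N = (\<Sum>j = 1..N - 2. cmod (t_X X N j))"

definition C_X :: "seq_kind \<Rightarrow> nat \<Rightarrow> real" where
  "C_X X N = (a_X X N - real N * a_X X (N - 1)) / 2"

definition kappa_X :: "seq_kind \<Rightarrow> nat \<Rightarrow> real" where
  "kappa_X X N = M_X X N / \<bar>C_X X N\<bar>"

fun c_X :: "seq_kind \<Rightarrow> real" where
  "c_X Fibonacci = 1 / sqrt 5"
| "c_X Lucas = 1"

definition alpha :: real where
  "alpha = (1 + sqrt 5) / 2"

definition alpha_sq :: real where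
  "alpha_sq = alpha\<^sup>2"

abbreviation evens_at_top :: "nat filter" where
  "evens_at_top \<equiv> inf at_top (principal {N. even N})"

text \<open>
  The relation \<open>u \<sim> v\<close> along the even integers, literally as \<open>u N / v N \<longlongrightarrow> 1\<close>.
  (The library's asymptotic equivalence in addition counts \<open>0 / 0\<close> as \<open>1\<close>.)
\<close>

definition sim_evens :: "(nat \<Rightarrow> real) \<Rightarrow> (nat \<Rightarrow> real) \<Rightarrow> bool" where
  "sim_evens u v \<longleftrightarrow> ((\<lambda>N. u N / v N) \<longlongrightarrow> 1) evens_at_top"

end

theory Submission
  imports Defs "HOL-Real_Asymp.Real_Asymp"
begin

text \<open>
  Splitting \<open>\<Gamma>(s) \<zeta>(s) = \<integral> x\<^bsup>s-1\<^esup> / (e\<^bsup>x\<^esup> - 1) dx\<close> at \<open>x = 1\<close> and expanding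
  \<open>x / (e\<^bsup>x\<^esup> - 1)\<close> on the lower part continues \<open>\<zeta>\<close> meromorphically: the lower part becomes a sum of
  simple poles, the upper part is entire. The partial fractions of the cotangent express the
  coefficients of the expansion through \<open>\<zeta>\<close> at even arguments, whence
  \<open>\<zeta>(1 - 2k) = \<plusminus> 2 (2k - 1)! \<zeta>(2k) / (2\<pi>)\<^bsup>2k\<^esup>\<close> and \<open>\<zeta>(-2k) = 0\<close>. Therefore
  \<open>M\<^sub>N = N!/\<pi>\<^bsup>N\<^esup> \<Sum> a\<^sub>j \<pi>\<^bsup>j\<^esup>/j! \<zeta>(N - j)\<close> over the even \<open>j\<close> from \<open>2\<close> to \<open>N - 2\<close>, and since
  \<open>\<zeta>(m) = 1 + O(2\<^bsup>-m\<^esup>)\<close> the sum is \<open>D + O(2\<^bsup>-N\<^esup>)\<close>. Binet's formula gives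
  \<open>a\<^sub>j = c r\<^bsup>j\<^esup> + O(\<alpha>\<^bsup>j\<^esup>)\<close>, so \<open>C\<^sub>N = -(c/2) r\<^bsup>N-1\<^esup> (N - r) (1 + O(\<alpha>\<^bsup>-N\<^esup>))\<close>, and this
  error dominates because \<open>\<alpha> < 2\<close>.
\<close>

subsection \<open>Partial fractions of the cotangent\<close>

text \<open>Differentiating the reflection formula
  \<open>rGamma z * rGamma (1 - z) = sin (pi * z) / pi\<close> and dividing by it gives the
  cotangent; off the integers neither factor vanishes.\<close>

lemma Digamma_reflection_complex:
  fixes z :: complex
  assumes "z \<notin> \<int>"
  shows "Digamma (1 - z) - Digamma z = of_real pi * cot (of_real pi * z)"
proof -
  have z: "z \<notin> \<int>\<^sub>\<le>\<^sub>0" and z': "1 - z \<notin> \<int>\<^sub>\<le>\<^sub>0"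
    using assms nonpos_Ints_subset_Ints Ints_diff[of 1 "1 - z"] by auto
  have "((\<lambda>w. rGamma w * rGamma (1 - w)) has_field_derivative
      rGamma z * rGamma (1 - z) * (Digamma (1 - z) - Digamma z)) (at z)"
    using z z' by (auto intro!: derivative_eq_intros simp: algebra_simps)
  moreover have "((\<lambda>w. sin (of_real pi * w) / of_real pi) has_field_derivative cos (of_real pi * z)) (at z)"
    by (auto intro!: derivative_eq_intros)
  ultimately have "rGamma z * rGamma (1 - z) * (Digamma (1 - z) - Digamma z) = cos (of_real pi * z)"
    unfolding rGamma_reflection_complex by (rule DERIV_unique)
  moreover have "rGamma z \<noteq> 0" "rGamma (1 - z) \<noteq> 0"
    using z z' by (auto simp: rGamma_eq_zero_iff)
  moreover have "sin (of_real pi * z) = of_real pi * (rGamma z * rGamma (1 - z))"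
    using rGamma_reflection_complex[of z] by (simp add: field_simps)
  ultimately show ?thesis
    by (simp add: cot_def field_simps)
qed

text \<open>The Digamma series at \<open>1 - z\<close> and \<open>1 + z\<close> are subtracted, so
  that the harmonic terms cancel; the recurrence for \<open>Digamma (1 + z)\<close> accounts for the
  extra \<open>1 / z\<close>.\<close>

lemma cot_partial_fractions:
  fixes z :: complex
  assumes "z \<notin> \<int>"
  shows "(\<lambda>k. 1 / (z + of_nat (Suc k)) + 1 / (z - of_nat (Suc k))) sums
    (of_real pi * cot (of_real pi * z) - 1 / z)"
proof -
  have nz: "z \<noteq> 0" "1 + z \<noteq> 0" "1 - z \<noteq> 0"
    using assms by (auto simp: add_eq_0_iff)
  have "(\<lambda>k. inverse (of_nat (Suc k)) - inverse (w + of_nat k)) sums (Digamma w + euler_mascheroni)"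
    if "w \<noteq> 0" for w :: complex
    using summable_sums[OF summable_Digamma[OF that]] by (simp add: Digamma_def)
  from sums_diff[OF this[of "1 - z"] this[of "1 + z"]] nz
  have "(\<lambda>k. inverse (1 + z + of_nat k) - inverse (1 - z + of_nat k)) sums (Digamma (1 - z) - Digamma (1 + z))"
    by simp
  moreover have "Digamma (1 - z) - Digamma (1 + z) = of_real pi * cot (of_real pi * z) - 1 / z"
    using Digamma_reflection_complex[OF assms] Digamma_plus1[OF nz(1)] by (simp add: add.commute)
  moreover have "inverse (1 + z + of_nat k) - inverse (1 - z + of_nat k)
      = 1 / (z + of_nat (Suc k)) + 1 / (z - of_nat (Suc k))" for k
  proof -
    have "1 / (z - of_nat (Suc k)) = - inverse (1 - z + of_nat k)"
      unfolding inverse_eq_divide minus_divide_right by (simp add: algebra_simps)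
    thus ?thesis by (simp add: inverse_eq_divide algebra_simps)
  qed
  ultimately show ?thesis by simp
qed

text \<open>At \<open>z = i x / (2 pi)\<close> the cotangent becomes hyperbolic, with
  \<open>(x / 2) coth (x / 2) = x / (exp x - 1) + x / 2\<close>. Multiplying the expansion by
  \<open>z\<close> turns each pair of poles into \<open>2 z^2 / (z^2 - n^2)\<close>, which is real
  and positive.\<close>

lemma bernoulli_function_partial_fractions:
  fixes x :: real
  assumes "x > 0"
  shows "(\<lambda>k. 2 * x\<^sup>2 / (x\<^sup>2 + (2 * pi * Suc k)\<^sup>2)) sums (x / (exp x - 1) - 1 + x / 2)"
proof -
  define z where "z = \<i> * of_real (x / (2 * pi))"
  have z2: "z\<^sup>2 = - of_real (x\<^sup>2 / (2 * pi)\<^sup>2)"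
    by (simp add: z_def power_mult_distrib power_divide)
  have "z \<notin> \<int>"
    using assms by (auto simp: z_def complex_is_Int_iff)
  hence *: "(\<lambda>k. z * (1 / (z + of_nat (Suc k)) + 1 / (z - of_nat (Suc k)))) sums
    (z * (of_real pi * cot (of_real pi * z) - 1 / z))"
    by (intro sums_mult cot_partial_fractions)
  have t: "z * (1 / (z + of_nat (Suc k)) + 1 / (z - of_nat (Suc k))) =
      of_real (2 * x\<^sup>2 / (x\<^sup>2 + (2 * pi * Suc k)\<^sup>2))" for k
  proof -
    let ?n = "of_nat (Suc k) :: complex"
    have nz: "z + ?n \<noteq> 0" "z - ?n \<noteq> 0"
      using assms by (auto simp: complex_eq_iff z_def simp del: of_nat_Suc)
    have "z * (1 / (z + ?n) + 1 / (z - ?n)) = 2 * z\<^sup>2 / (z\<^sup>2 - ?n\<^sup>2)"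
      using nz by (simp add: divide_simps square_diff_square_factored power2_eq_square del: of_nat_Suc)
    also have "\<dots> = of_real (2 * (- (x\<^sup>2 / (2 * pi)\<^sup>2)) / (- (x\<^sup>2 / (2 * pi)\<^sup>2) - (real (Suc k))\<^sup>2))"
      unfolding z2 by (simp del: of_nat_Suc)
    also have "2 * (- (x\<^sup>2 / (2 * pi)\<^sup>2)) / (- (x\<^sup>2 / (2 * pi)\<^sup>2) - (real (Suc k))\<^sup>2)
        = 2 * x\<^sup>2 / (x\<^sup>2 + (2 * pi * Suc k)\<^sup>2)"
    proof -
      define d where "d = x\<^sup>2 + (2 * pi * Suc k)\<^sup>2"
      have "d > 0" using assms by (simp add: d_def add_pos_nonneg)
      have eq: "- (x\<^sup>2 / (2 * pi)\<^sup>2) - (real (Suc k))\<^sup>2 = - d / (2 * pi)\<^sup>2"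
        by (simp add: d_def field_simps del: of_nat_Suc)
      show ?thesis using \<open>d > 0\<close> unfolding eq d_def[symmetric] by (simp add: field_simps)
    qed
    finally show ?thesis .
  qed
  have "z * (of_real pi * cot (of_real pi * z) - 1 / z) = of_real (x / (exp x - 1) - 1 + x / 2)"
  proof -
    define E where "E = exp (x / 2)"
    have E: "E > 1" "exp x = E\<^sup>2" using assms by (auto simp: E_def exp_double[symmetric])
    have pz: "of_real pi * z = \<i> * of_real (x / 2)" by (simp add: z_def)
    have ct: "cot (\<i> * of_real (x / 2)) = - \<i> * of_real ((E + 1 / E) / (E - 1 / E))"
    proof -
      have ii: "\<i> * (\<i> * complex_of_real (x / 2)) = of_real (- (x / 2))"
        "- (\<i> * (\<i> * complex_of_real (x / 2))) = of_real (x / 2)"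
        unfolding mult.assoc[symmetric] by auto
      have e: "exp (complex_of_real (- (x / 2))) = of_real (1 / E)"
        "exp (- complex_of_real (- (x / 2))) = of_real E"
        by (simp_all only: E_def exp_of_real of_real_minus[symmetric] minus_minus exp_minus inverse_eq_divide)
      have "(a + b) / 2 / ((a - b) / (2 * \<i>)) = - \<i> * ((b + a) / (b - a))" if "a \<noteq> b" for a b :: complex
        using that by (simp add: divide_simps) (simp add: algebra_simps)
      moreover have "complex_of_real (1 / E) \<noteq> of_real E"
        unfolding of_real_eq_iff using E(1) by (simp add: divide_simps) (metis less_1_mult less_irrefl)
      ultimately have "(complex_of_real (1 / E) + of_real E) / 2 / ((of_real (1 / E) - of_real E) / (2 * \<i>))
          = - \<i> * ((of_real E + of_real (1 / E)) / (of_real E - of_real (1 / E)))" by blast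
      thus ?thesis unfolding cot_def sin_exp_eq cos_exp_eq ii e of_real_add of_real_diff of_real_divide[of "E + 1 / E"] .
    qed
    have rl: "x / 2 * ((E + 1 / E) / (E - 1 / E)) = x / (exp x - 1) + x / 2"
    proof -
      have "E\<^sup>2 - 1 > 0" using E(1) by simp
      moreover have eq: "(E + 1 / E) / (E - 1 / E) = (E\<^sup>2 + 1) / (E\<^sup>2 - 1)"
        using E(1) by (simp add: divide_simps power2_eq_square)
      ultimately show ?thesis unfolding eq E(2) by (simp add: field_simps)
    qed
    have "z \<noteq> 0" using assms by (simp add: z_def)
    hence zz: "z * (of_real pi * cot (of_real pi * z) - 1 / z) = (of_real pi * z) * cot (of_real pi * z) - 1"
      by (simp add: field_simps)
    have uv: "(\<i> * of_real u) * (- \<i> * of_real v) = complex_of_real (u * v)" for u v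
      by (simp add: complex_eq_iff)
    show ?thesis unfolding zz unfolding pz unfolding ct unfolding uv rl by simp
  qed
  with * show ?thesis unfolding t by (simp only: sums_of_real_iff)
qed

subsection \<open>The Bernoulli generating function\<close>

text \<open>This is zeta(k) for \<open>k \<ge> 2\<close>, kept as a real series so that estimating
  it does not involve the continuation.\<close>

definition pseries :: "nat \<Rightarrow> real" where
  "pseries k = (\<Sum>n. 1 / real (Suc n) ^ k)"

lemma summable_pseries: "k \<ge> 2 \<Longrightarrow> summable (\<lambda>n. 1 / real (Suc n) ^ k)"
  using inverse_power_summable[of k, where 'a = real]
    summable_Suc_iff[of "\<lambda>n. inverse (real n ^ k)"] unfolding inverse_eq_divide by simp

text \<open>For \<open>n \<ge> 2\<close> one has \<open>n^k \<ge> n^2 * 2^(k-2)\<close>, so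
  everything beyond the first term is at most \<open>4 / 2^k\<close> times its value for
  \<open>k = 2\<close>. This is the source of the error rate \<open>2^(-N)\<close> in
  \<open>M_X\<close>.\<close>

lemma pseries_bounds:
  assumes "k \<ge> 2"
  shows "1 \<le> pseries k" and "pseries k \<le> 1 + 4 * pseries 2 / 2 ^ k"
proof -
  note s = summable_pseries[OF assms] and s2 = summable_pseries[of 2]
  have split: "pseries k = 1 + (\<Sum>n. 1 / real (Suc (Suc n)) ^ k)" if "k \<ge> 2" for k
    using suminf_split_head[OF summable_pseries[OF that]] by (simp add: pseries_def)
  have st: "summable (\<lambda>n. 1 / real (Suc (Suc n)) ^ k)" if "k \<ge> 2" for k
    using summable_pseries[OF that] summable_Suc_iff[of "\<lambda>n. 1 / real (Suc n) ^ k"] by simp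
  show "1 \<le> pseries k"
    unfolding split[OF assms] using suminf_nonneg[OF st[OF assms]] by simp
  have "(\<Sum>n. 1 / real (Suc (Suc n)) ^ k) \<le> (\<Sum>n. 4 / 2 ^ k * (1 / real (Suc (Suc n)) ^ 2))"
  proof (intro suminf_le st assms summable_mult)
    fix n
    have k: "k = 2 + (k - 2)" using assms by simp
    have "(2::real) ^ (k - 2) \<le> real (Suc (Suc n)) ^ (k - 2)"
      by (intro power_mono) auto
    hence "real (Suc (Suc n)) ^ 2 * 2 ^ (k - 2) \<le> real (Suc (Suc n)) ^ k"
      by (subst (2) k, subst power_add) (intro mult_left_mono, auto)
    moreover have "(2::real) ^ k = 4 * 2 ^ (k - 2)"
      by (subst k, subst power_add) simp
    ultimately show "1 / real (Suc (Suc n)) ^ k \<le> 4 / 2 ^ k * (1 / real (Suc (Suc n)) ^ 2)"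
      by (simp add: divide_simps mult.commute del: of_nat_Suc)
  qed simp
  also have "\<dots> = 4 / 2 ^ k * (\<Sum>n. 1 / real (Suc (Suc n)) ^ 2)"
    by (intro suminf_mult st) simp
  also have "\<dots> \<le> 4 / 2 ^ k * pseries 2"
    by (intro mult_left_mono) (use split[of 2] in auto)
  finally show "pseries k \<le> 1 + 4 * pseries 2 / 2 ^ k"
    unfolding split[OF assms] by simp
qed

text \<open>The value is \<open>B\<^bsub>2m+2\<^esub> / (2m+2)!\<close> in terms of Bernoulli numbers.\<close>

definition bern_coeff :: "nat \<Rightarrow> real" where
  "bern_coeff m = 2 * (-1) ^ m * pseries (2 * m + 2) / (2 * pi) ^ (2 * m + 2)"

text \<open>Each partial fraction is a geometric series in \<open>- q / (k + 1)^2\<close>, where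
  \<open>q < 1\<close> because \<open>x < 2 pi\<close>. Exchanging the two summations collects the
  powers of \<open>x\<close>, and the sum over \<open>k\<close> produces
  \<open>pseries\<close>.\<close>

lemma bernoulli_function_power_series:
  fixes x :: real
  assumes x: "0 < x" "x < 2 * pi"
  shows "(\<lambda>m. bern_coeff m * x ^ (2 * m + 2)) sums (x / (exp x - 1) - 1 + x / 2)"
proof -
  define q where "q = (x / (2 * pi))\<^sup>2"
  have q: "0 < q" "q < 1"
    using x by (auto simp: q_def abs_square_less_1)
  define f where "f = (\<lambda>(k, m). 2 * q * (- q) ^ m / real (Suc k) ^ (2 * m + 2))"
  have inner: "((\<lambda>m. f (k, m)) has_sum (2 * x\<^sup>2 / (x\<^sup>2 + (2 * pi * Suc k)\<^sup>2))) UNIV" for k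
  proof (rule norm_summable_imp_has_sum)
    define y where "y = q / real (Suc k) ^ 2"
    have y: "0 < y" "y < 1"
    proof -
      have "(1::real) \<le> real (Suc k) ^ 2" by (rule one_le_power) simp
      hence "q < real (Suc k) ^ 2" using q by linarith
      thus "y < 1" "0 < y" using q by (auto simp: y_def)
    qed
    have f: "f (k, m) = 2 * y * (- y) ^ m" for m
    proof -
      have "real (Suc k) ^ (2 * m + 2) = (real (Suc k) ^ 2) ^ m * real (Suc k) ^ 2"
        by (simp only: power_add power_mult)
      moreover have "(- y) ^ m = (- q) ^ m / (real (Suc k) ^ 2) ^ m"
        unfolding y_def minus_divide_left power_divide ..
      ultimately show ?thesis by (simp add: f_def y_def del: of_nat_Suc)
    qed
    show "summable (\<lambda>m. norm (f (k, m)))"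
      unfolding f norm_mult norm_power using y by (intro summable_mult summable_geometric) auto
    have "(\<lambda>m. 2 * y * (- y) ^ m) sums (2 * y * (1 / (1 - (- y))))"
      using y by (intro sums_mult geometric_sums) auto
    also have "2 * y * (1 / (1 - (- y))) = 2 * x\<^sup>2 / (x\<^sup>2 + (2 * pi * Suc k)\<^sup>2)"
    proof -
      define s where "s = (2 * pi * real (Suc k))\<^sup>2"
      have "s > 0" by (auto simp: s_def)
      have "y = x\<^sup>2 / s" by (simp add: y_def q_def s_def power_divide power_mult_distrib)
      moreover have "s + x\<^sup>2 > 0" using \<open>s > 0\<close> by (simp add: add_pos_nonneg)
      ultimately show ?thesis using \<open>s > 0\<close> y unfolding s_def[symmetric] by (simp add: divide_simps) (simp add: algebra_simps)
    qed
    finally show "(\<lambda>m. f (k, m)) sums (2 * x\<^sup>2 / (x\<^sup>2 + (2 * pi * Suc k)\<^sup>2))"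
      unfolding f .
  qed
  have outer: "((\<lambda>k. 2 * x\<^sup>2 / (x\<^sup>2 + (2 * pi * Suc k)\<^sup>2)) has_sum (x / (exp x - 1) - 1 + x / 2)) UNIV"
    using bernoulli_function_partial_fractions[OF x(1)] by (rule sums_nonneg_imp_has_sum) simp
  \<comment> \<open>A majorant for the double series: lowering the exponent \<open>2 * m + 2\<close>
    of \<open>k + 1\<close> to \<open>2\<close> makes it a product of a convergent series in
    \<open>k\<close> and a geometric one in \<open>m\<close>.\<close>
  have "(\<lambda>(k, m). 2 * q * (1 / real (Suc k) ^ 2 * q ^ m)) summable_on UNIV \<times> UNIV"
  proof (rule summable_on_SigmaI)
    fix k :: nat
    show "((\<lambda>m. case (k, m) of (k, m) \<Rightarrow> 2 * q * (1 / real (Suc k) ^ 2 * q ^ m)) has_sum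
      (2 * q * (1 / real (Suc k) ^ 2 * (1 / (1 - q))))) UNIV"
      unfolding prod.case
      using q by (intro has_sum_cmult_right sums_nonneg_imp_has_sum geometric_sums) auto
    show "(\<lambda>k. 2 * q * (1 / real (Suc k) ^ 2 * (1 / (1 - q)))) summable_on UNIV"
      using summable_pseries[of 2]
      by (intro summable_on_cmult_right summable_on_cmult_left summable_nonneg_imp_summable_on) auto
  qed (use q in auto)
  hence "(\<lambda>p. norm (f p)) summable_on UNIV \<times> UNIV"
  proof (rule summable_on_comparison_test)
    fix p :: "nat \<times> nat"
    obtain k m where p: "p = (k, m)" by force
    have "real (Suc k) ^ 2 \<le> real (Suc k) ^ (2 * m + 2)"
      by (intro power_increasing) auto
    hence "2 * q * q ^ m / real (Suc k) ^ (2 * m + 2) \<le> 2 * q * q ^ m / real (Suc k) ^ 2"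
      using q by (intro divide_left_mono) auto
    thus "norm (f p) \<le> (case p of (k, m) \<Rightarrow> 2 * q * (1 / real (Suc k) ^ 2 * q ^ m))"
      using q by (simp add: f_def p abs_mult power_abs del: of_nat_Suc)
  qed auto
  hence "f summable_on UNIV \<times> UNIV" by (rule abs_summable_summable)
  from has_sum_SigmaI[OF inner outer this]
  \<comment> \<open>The value was found by summing over \<open>m\<close> first; after the swap the
    inner sum runs over \<open>k\<close> and yields the coefficient of a single power of
    \<open>x\<close>.\<close>
  have "((\<lambda>(m, k). f (k, m)) has_sum (x / (exp x - 1) - 1 + x / 2)) (UNIV \<times> UNIV)"
    by (subst (asm) has_sum_swap)
  moreover have "((\<lambda>k. case (m, k) of (m, k) \<Rightarrow> f (k, m)) has_sum bern_coeff m * x ^ (2 * m + 2)) UNIV" for m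
  proof -
    have "((\<lambda>k. 2 * q * (- q) ^ m * (1 / real (Suc k) ^ (2 * m + 2))) has_sum
       2 * q * (- q) ^ m * pseries (2 * m + 2)) UNIV"
      unfolding pseries_def
      by (intro has_sum_cmult_right sums_nonneg_imp_has_sum summable_sums summable_pseries) auto
    moreover have "2 * q * (- q) ^ m * pseries (2 * m + 2) = bern_coeff m * x ^ (2 * m + 2)"
    proof -
      have eq: "x ^ (2 * m + 2) / (2 * pi) ^ (2 * m + 2) = q ^ m * q"
        unfolding q_def power_divide[symmetric] by (simp only: power_add power_mult)
      have "bern_coeff m * x ^ (2 * m + 2) =
          2 * (-1) ^ m * pseries (2 * m + 2) * (x ^ (2 * m + 2) / (2 * pi) ^ (2 * m + 2))"
        unfolding bern_coeff_def by (simp only: times_divide_eq_left times_divide_eq_right)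
      thus ?thesis unfolding eq power_minus[of q] by (simp only: mult_ac)
    qed
    ultimately show ?thesis by (simp add: f_def)
  qed
  ultimately have "((\<lambda>m. bern_coeff m * x ^ (2 * m + 2)) has_sum (x / (exp x - 1) - 1 + x / 2)) UNIV"
    by (rule has_sum_SigmaD)
  thus ?thesis by (rule has_sum_imp_sums)
qed

text \<open>The radius of convergence \<open>2 pi\<close> exceeds 1. Absolute summability justifies
  termwise integration over \<open>(0, 1]\<close> and the convergence of the sum over the
  poles.\<close>

lemma summable_bern_coeff: "summable (\<lambda>m. \<bar>bern_coeff m\<bar>)"
proof (rule summable_comparison_test)
  have "\<bar>bern_coeff m\<bar> \<le> 2 * (1 + pseries 2) * (1 / 4) ^ m" for m
  proof -
    have "pseries (2 * m + 2) \<le> 1 + 4 * pseries 2 / 2 ^ (2 * m + 2)"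
      by (rule pseries_bounds) simp
    also have "\<dots> \<le> 1 + pseries 2 * 1"
    proof -
      have "4 / 2 ^ (2 * m + 2) \<le> (1::real)" by simp
      from mult_left_mono[OF this, of "pseries 2"] pseries_bounds(1)[of 2] show ?thesis by simp
    qed
    finally have p: "pseries (2 * m + 2) \<le> 1 + pseries 2" by simp
    have "(2::real) ^ (2 * m) \<le> (2 * pi) ^ (2 * m + 2)"
      using pi_gt3 by (intro order.trans[OF power_mono power_increasing]) auto
    moreover have "pseries (2 * m + 2) \<ge> 1" by (rule pseries_bounds) simp
    ultimately have "2 * pseries (2 * m + 2) / (2 * pi) ^ (2 * m + 2) \<le> 2 * (1 + pseries 2) / 2 ^ (2 * m)"
      using p by (intro frac_le) auto
    also have "\<dots> = 2 * (1 + pseries 2) * (1 / 4) ^ m"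
      by (simp add: power_mult power_one_over)
    finally show ?thesis using \<open>pseries (2 * m + 2) \<ge> 1\<close>
      by (simp add: bern_coeff_def abs_mult power_abs)
  qed
  thus "\<exists>N. \<forall>n\<ge>N. norm \<bar>bern_coeff n\<bar> \<le> 2 * (1 + pseries 2) * (1 / 4) ^ n" by auto
qed (intro summable_mult summable_geometric, simp)

subsection \<open>The Mellin integral\<close>

lemma continuous_on_complex_powr_greaterThan_0:
  "continuous_on {0<..} (\<lambda>x. complex_of_real x powr w)"
  by (auto intro!: continuous_intros simp: complex_nonpos_Reals_iff)

lemma set_borel_measurable_powr_mult:
  assumes "A \<in> sets borel" "A \<subseteq> {0<..}" "continuous_on A g"
  shows "set_borel_measurable lborel A (\<lambda>x. complex_of_real x powr w * g x)"
proof -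
  have cont: "continuous_on A (\<lambda>x. complex_of_real x powr w * g x)"
    by (intro continuous_on_mult assms continuous_on_subset[OF continuous_on_complex_powr_greaterThan_0])
  thus ?thesis unfolding set_borel_measurable_def
    using borel_measurable_continuous_on_indicator[OF _ cont] assms by simp
qed

text \<open>Euler's integral under the substitution \<open>x -> a x\<close>. Borel measurability of
  the integrand carries integrability from \<open>lebesgue\<close> to \<open>lborel\<close>.\<close>

lemma Gamma_integral_scaled:
  fixes s :: complex and a :: real
  assumes s: "Re s > 0" and a: "a > 0"
  shows "set_integrable lborel {0<..} (\<lambda>x. of_real x powr (s - 1) * of_real (exp (- (a * x))))"
    and "(LINT x:{0<..}|lborel. of_real x powr (s - 1) * of_real (exp (- (a * x)))) = Gamma s / of_real a powr s"
proof -
  have int: "set_integrable lborel {0<..} (\<lambda>x. of_real x powr (s - 1) * of_real (exp (- (a * x))))"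
    if "a > 0" for a
  proof -
    have "set_integrable lebesgue {0<..} (\<lambda>x. of_real x powr (s - 1) * complex_of_real (exp (- (a * x))))"
      using absolutely_integrable_Gamma_integral[OF s that] by (simp add: exp_minus field_simps)
    moreover have "set_borel_measurable lborel {0<..} (\<lambda>x. of_real x powr (s - 1) * complex_of_real (exp (- (a * x))))"
      by (intro set_borel_measurable_powr_mult) (auto intro!: continuous_intros)
    ultimately show ?thesis
      unfolding set_integrable_def set_borel_measurable_def by (simp add: integrable_completion)
  qed
  thus "set_integrable lborel {0<..} (\<lambda>x. of_real x powr (s - 1) * of_real (exp (- (a * x))))"
    using a by blast
  have "(LINT x:{0<..}|lborel. of_real x powr (s - 1) * complex_of_real (exp (- x))) = Gamma s"
    using set_borel_integral_eq_integral(2)[OF int[of 1]] Gamma_integral_complex'[OF s]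
    by (simp add: exp_minus field_simps integral_unique)
  moreover have "(LINT x:{0<..}|lborel. of_real x powr (s - 1) * complex_of_real (exp (- x))) =
     \<bar>a\<bar> *\<^sub>R (LBINT x. indicator {0<..} (0 + a * x) *\<^sub>R (of_real (0 + a * x) powr (s - 1) * complex_of_real (exp (- (0 + a * x)))))"
    unfolding set_lebesgue_integral_def using a by (intro lborel_integral_real_affine) auto
  moreover have "(\<lambda>x. indicator {0<..} (0 + a * x) *\<^sub>R (of_real (0 + a * x) powr (s - 1) * complex_of_real (exp (- (0 + a * x)))))
     = (\<lambda>x. of_real a powr (s - 1) * (indicator {0<..} x *\<^sub>R (of_real x powr (s - 1) * complex_of_real (exp (- (a * x))))))"
    using a by (auto simp: fun_eq_iff indicator_def zero_less_mult_iff powr_times_real)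
  ultimately have "Gamma s = of_real a * of_real a powr (s - 1) *
      (LINT x:{0<..}|lborel. of_real x powr (s - 1) * of_real (exp (- (a * x))))"
    using a by (simp add: set_lebesgue_integral_def scaleR_conv_of_real)
  moreover have "of_real a * of_real a powr (s - 1) = complex_of_real a powr s"
    using a by (simp add: powr_diff)
  ultimately show "(LINT x:{0<..}|lborel. of_real x powr (s - 1) * of_real (exp (- (a * x)))) = Gamma s / of_real a powr s"
    using a by (simp add: field_simps)
qed

definition mellin_kernel :: "complex \<Rightarrow> real \<Rightarrow> complex" where
  "mellin_kernel s x = of_real x powr (s - 1) / of_real (exp x - 1)"

lemma norm_mellin_kernel: "x > 0 \<Longrightarrow> norm (mellin_kernel s x) = x powr (Re s - 1) / (exp x - 1)"
  unfolding mellin_kernel_def norm_divide norm_of_real by (simp add: norm_powr_real_powr)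

lemma set_borel_measurable_mellin_kernel:
  assumes "A \<in> sets borel" "A \<subseteq> {0<..}"
  shows "set_borel_measurable lborel A (mellin_kernel s)"
proof -
  have "set_borel_measurable lborel A (\<lambda>x. of_real x powr (s - 1) * (1 / of_real (exp x - 1)))"
  proof (intro set_borel_measurable_powr_mult assms continuous_intros ballI)
    fix x assume "x \<in> A"
    thus "complex_of_real (exp x - 1) \<noteq> 0"
      using assms(2) unfolding of_real_eq_0_iff by auto
  qed
  thus ?thesis by (simp add: mellin_kernel_def[abs_def])
qed

text \<open>Expand \<open>1 / (exp x - 1)\<close> as a geometric series in \<open>exp (- x)\<close>.
  The term with \<open>exp (- (n + 1) x)\<close> integrates to \<open>Gamma s / (n + 1)^s\<close>,
  and the integrals of the norms are summable because \<open>Re s > 1\<close>.\<close>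

lemma mellin_kernel_integral:
  assumes s: "Re s > 1"
  shows "set_integrable lborel {0<..} (mellin_kernel s)" (is ?int)
    and "(\<lambda>n. 1 / of_nat (Suc n) powr s) sums (rGamma s * (LINT x:{0<..}|lborel. mellin_kernel s x))"
proof -
  \<comment> \<open>The exponent is an argument of \<open>f\<close> because the norm of the term at
    \<open>s\<close> is the term at \<open>Re s\<close>; one formula then gives both the integrals
    and the integrals of the norms.\<close>
  define f where "f = (\<lambda>s n x. indicator {0<..} x *\<^sub>R (of_real x powr (s - 1) * complex_of_real (exp (- (real (Suc n) * x)))))"
  have f_int: "integrable lborel (f s n)" "integral\<^sup>L lborel (f s n) = Gamma s / of_nat (Suc n) powr s"
    if "Re s > 0" for s n
    using Gamma_integral_scaled[OF that, of "real (Suc n)"]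
    by (simp_all add: f_def set_integrable_def set_lebesgue_integral_def del: of_nat_Suc)
  have norm_f: "complex_of_real (norm (f s n x)) = f (of_real (Re s)) n x" for n x
    by (simp add: f_def indicator_def norm_mult norm_powr_real_powr flip: powr_of_real)
  have int_norm: "(\<integral>x. norm (f s n x) \<partial>lborel) = Gamma (Re s) / real (Suc n) powr (Re s)" for n
  proof -
    have "complex_of_real (\<integral>x. norm (f s n x) \<partial>lborel) = (\<integral>x. f (of_real (Re s)) n x \<partial>lborel)"
      unfolding norm_f[symmetric] by simp
    also have "\<dots> = of_real (Gamma (Re s) / real (Suc n) powr (Re s))"
      using s by (subst f_int) (auto simp: Gamma_complex_of_real powr_of_real[symmetric])
    finally show ?thesis unfolding of_real_eq_iff .
  qed
  have sum_exp: "(\<lambda>n. exp (- (real (Suc n) * x))) sums (1 / (exp x - 1))" if "x > 0" for x :: real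
  proof -
    have "(\<lambda>n. exp (- x) * exp (- x) ^ n) sums (exp (- x) * (1 / (1 - exp (- x))))"
      using that by (intro sums_mult geometric_sums) auto
    moreover have "exp (- x) * (1 / (1 - exp (- x))) = 1 / (exp x - 1)"
      using that by (simp add: exp_minus divide_simps)
    moreover have "exp (- x) * exp (- x) ^ n = exp (- (real (Suc n) * x))" for n
      using exp_of_nat_mult[of "Suc n" "- x"] by simp
    ultimately show ?thesis by simp
  qed
  have sum_f: "(\<Sum>n. f s n x) = indicator {0<..} x *\<^sub>R mellin_kernel s x"
    and summable_f: "summable (\<lambda>n. norm (f s n x))" for x
  proof -
    have "(\<lambda>n. f s n x) sums (indicator {0<..} x *\<^sub>R mellin_kernel s x)"
    proof (cases "x > 0")
      case True
      have "(\<lambda>n. of_real x powr (s - 1) * complex_of_real (exp (- (real (Suc n) * x)))) sums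
        (of_real x powr (s - 1) * of_real (1 / (exp x - 1)))"
        by (intro sums_mult sums_of_real sum_exp True)
      thus ?thesis using True by (simp add: f_def mellin_kernel_def)
    qed (simp add: f_def)
    thus "(\<Sum>n. f s n x) = indicator {0<..} x *\<^sub>R mellin_kernel s x" by (simp add: sums_iff)
    show "summable (\<lambda>n. norm (f s n x))"
    proof (cases "x > 0")
      case True
      have "summable (\<lambda>n. norm (of_real x powr (s - 1) :: complex) * exp (- (real (Suc n) * x)))"
        using sum_exp[OF True] by (intro summable_mult) (simp add: sums_iff)
      thus ?thesis using True by (simp add: f_def norm_mult)
    qed (simp add: f_def)
  qed
  have "summable (\<lambda>n. \<integral>x. norm (f s n x) \<partial>lborel)"
  proof -
    have "summable (\<lambda>n. real n powr (- Re s))" using s by (simp add: summable_real_powr_iff)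
    hence "summable (\<lambda>n. real (Suc n) powr (- Re s))" by (subst summable_Suc_iff)
    hence "summable (\<lambda>n. Gamma (Re s) * real (Suc n) powr (- Re s))" by (rule summable_mult)
    thus ?thesis unfolding int_norm by (simp add: powr_minus divide_inverse)
  qed
  note * = f_int(1) AE_I2[OF summable_f] this
  show ?int unfolding set_integrable_def using integrable_suminf[OF *] s by (simp add: sum_f)
  have "(\<lambda>n. rGamma s * integral\<^sup>L lborel (f s n)) sums (rGamma s * (LINT x:{0<..}|lborel. mellin_kernel s x))"
    unfolding set_lebesgue_integral_def using sums_integral[OF *] s by (intro sums_mult) (simp add: sum_f)
  moreover have "rGamma s * Gamma s = 1"
  proof -
    have "s \<notin> \<int>\<^sub>\<le>\<^sub>0" using s by (auto elim!: nonpos_Ints_cases)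
    thus ?thesis by (simp add: Gamma_def rGamma_eq_zero_iff)
  qed
  ultimately show "(\<lambda>n. 1 / of_nat (Suc n) powr s) sums (rGamma s * (LINT x:{0<..}|lborel. mellin_kernel s x))"
    using s by (simp add: f_int)
qed

section \<open>The integral over \<open>(0, 1]\<close> as a sum of simple poles\<close>

lemma powr_integral_unit_interval:
  assumes w: "Re w > 0"
  shows "set_integrable lborel {0<..1} (\<lambda>x. complex_of_real x powr (w - 1))" (is ?int)
    and "(LINT x:{0<..1}|lborel. complex_of_real x powr (w - 1)) = 1 / w"
proof -
  have meas: "set_borel_measurable lborel {0<..1} (\<lambda>x. complex_of_real x powr (w - 1))"
    using set_borel_measurable_powr_mult[of "{0<..1}" "\<lambda>_. 1" "w - 1"]
    by (simp add: greaterThanAtMost_def)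
  have "set_integrable lborel {0<..1} (\<lambda>x. of_real x powr (w - 1) * complex_of_real (exp (- (1 * x))))"
    by (rule set_integrable_subset[OF Gamma_integral_scaled(1)]) (use w in auto)
  \<comment> \<open>The Gamma integrand times \<open>exp 1\<close> dominates the power on
    \<open>(0, 1]\<close>, where \<open>exp (1 - x) \<ge> 1\<close>.\<close>
  hence "set_integrable lborel {0<..1} (\<lambda>x. exp 1 * (of_real x powr (w - 1) * complex_of_real (exp (- (1 * x)))))"
    by (rule set_integrable_mult_right)
  thus int: ?int
  proof (rule set_integrable_bound[OF _ meas])
    show "AE x in lborel. x \<in> {0<..1} \<longrightarrow> norm (complex_of_real x powr (w - 1)) \<le>
        norm (exp 1 * (of_real x powr (w - 1) * complex_of_real (exp (- (1 * x)))))"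
    proof (intro AE_I2 impI)
      fix x :: real assume x: "x \<in> {0<..1}"
      have "norm (exp 1 * (of_real x powr (w - 1) * complex_of_real (exp (- (1 * x))))) =
          norm (complex_of_real x powr (w - 1)) * (exp 1 * exp (- x))"
        by (simp add: norm_mult)
      moreover have "exp 1 * exp (- x) \<ge> 1" using x by (simp flip: exp_add)
      ultimately show "norm (complex_of_real x powr (w - 1)) \<le>
        norm (exp 1 * (of_real x powr (w - 1) * complex_of_real (exp (- (1 * x)))))"
        using mult_left_mono[of 1 "exp 1 * exp (- x)" "norm (complex_of_real x powr (w - 1))"] by simp
    qed
  qed
  have w0: "w \<noteq> 0" using w by auto
  have "((\<lambda>x. complex_of_real x powr (w - 1)) has_integral
     (complex_of_real 1 powr w / w - complex_of_real 0 powr w / w)) {0..1}"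
  proof (rule fundamental_theorem_of_calculus_interior)
    show "continuous_on {0..1} (\<lambda>x. complex_of_real x powr w / w)"
      using w by (intro continuous_intros continuous_on_powr_complex) (auto simp: complex_nonneg_Reals_iff)
    fix x :: real assume x: "x \<in> {0<..<1}"
    have "((\<lambda>z. z powr w / w) has_field_derivative (of_real x powr (w - 1))) (at (complex_of_real x))"
      using x w0 by (auto intro!: derivative_eq_intros simp: complex_nonpos_Reals_iff)
    thus "((\<lambda>x. complex_of_real x powr w / w) has_vector_derivative complex_of_real x powr (w - 1)) (at x)"
      by (rule has_vector_derivative_real_field)
  qed simp
  hence "((\<lambda>x. complex_of_real x powr (w - 1)) has_integral (1 / w)) {0..1}" by simp
  hence "((\<lambda>x. complex_of_real x powr (w - 1)) has_integral (1 / w)) {0<..1}"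
    by (subst has_integral_spike_set_eq[of _ "{0..1}"])
       (auto intro: negligible_subset[of "{0}"] simp: subset_eq)
  thus "(LINT x:{0<..1}|lborel. complex_of_real x powr (w - 1)) = 1 / w"
    using set_borel_integral_eq_integral(2)[OF int] by (simp add: integral_unique)
qed

text \<open>On \<open>(0, 1]\<close> the kernel is \<open>x^(s-2)\<close> times the expansion of
  \<open>x / (exp x - 1)\<close>, hence \<open>x^(s-2) - x^(s-1) / 2\<close> plus the terms
  \<open>bern_coeff m * x^(s+2m)\<close>. Integrating termwise gives the fractions;
  \<open>Re s > 1\<close> makes the leading power integrable.\<close>

lemma mellin_kernel_integral_unit_interval:
  assumes s: "Re s > 1"
  shows "(\<lambda>m. of_real (bern_coeff m) / (s + of_nat (2 * m + 1))) sums
    ((LINT x:{0<..1}|lborel. mellin_kernel s x) - 1 / (s - 1) + 1 / (2 * s))"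
proof -
  define I where "I = (\<lambda>w x. indicator {0<..1} x *\<^sub>R complex_of_real x powr (w - 1))"
  have I_int: "integrable lborel (I w)" "integral\<^sup>L lborel (I w) = 1 / w" if "Re w > 0" for w
    using powr_integral_unit_interval[OF that]
    by (simp_all add: I_def set_integrable_def set_lebesgue_integral_def)
  define f where "f = (\<lambda>m x. of_real (bern_coeff m) * I (s + of_nat (2 * m + 1)) x)"
  have Re_pos: "Re (s + of_nat (2 * m + 1)) > 0" for m using s by simp
  have f_int: "integrable lborel (f m)" for m
    unfolding f_def by (intro integrable_mult_right I_int Re_pos)
  have norm_f: "norm (f m x) \<le> \<bar>bern_coeff m\<bar> * indicator {0<..1} x" for m x
  proof (cases "x \<in> {0<..1}")
    case True
    have "norm (complex_of_real x powr (s + of_nat (2 * m + 1) - 1)) \<le> 1"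
      using True s by (simp add: norm_powr_real_powr powr_le1)
    from mult_left_mono[OF this, of "\<bar>bern_coeff m\<bar>"] show ?thesis
      using True by (simp add: f_def I_def norm_mult)
  qed (simp add: f_def I_def)
  have summable_f: "summable (\<lambda>m. norm (f m x))" for x
    by (rule summable_comparison_test[OF _ summable_mult2[OF summable_bern_coeff, of "indicator {0<..1} x"]])
      (use norm_f in auto)
  have "(\<integral>x. norm (f m x) \<partial>lborel) \<le> \<bar>bern_coeff m\<bar>" for m
  proof -
    have "(\<integral>x. norm (f m x) \<partial>lborel) \<le> (\<integral>x. \<bar>bern_coeff m\<bar> * indicator {0<..1::real} x \<partial>lborel)"
      by (intro integral_mono norm_f integrable_norm f_int integrable_mult_right) (auto simp: integrable_indicator_iff)
    thus ?thesis by simp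
  qed
  hence "summable (\<lambda>m. \<integral>x. norm (f m x) \<partial>lborel)"
    by (intro summable_comparison_test[OF _ summable_bern_coeff]) auto
  note * = f_int AE_I2[OF summable_f] this
  have sum_f: "(\<Sum>m. f m x) = indicator {0<..1} x *\<^sub>R mellin_kernel s x - I (s - 1) x + I s x / 2" for x
  proof (cases "x \<in> {0<..1}")
    case True
    have "(\<lambda>m. complex_of_real x powr (s - 2) * of_real (bern_coeff m * x ^ (2 * m + 2))) sums
      (of_real x powr (s - 2) * of_real (x / (exp x - 1) - 1 + x / 2))"
      using True pi_gt3 by (intro sums_mult sums_of_real bernoulli_function_power_series) auto
    moreover have "complex_of_real x powr (s - 2) * of_real (bern_coeff m * x ^ (2 * m + 2)) = f m x" for m
    proof -
      have "complex_of_real x powr (s + of_nat (2 * m + 1) - 1) = of_real x powr (s - 2) * of_real x powr (of_nat (2 * m + 2))"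
        unfolding powr_add[symmetric] by (simp add: algebra_simps)
      also have "of_real x powr (of_nat (2 * m + 2)) = complex_of_real x ^ (2 * m + 2)"
        using True by (subst powr_nat) auto
      finally show ?thesis using True by (simp add: f_def I_def del: of_nat_add power_Suc)
    qed
    moreover have "complex_of_real x powr (s - 2) * of_real (x / (exp x - 1) - 1 + x / 2) =
        indicator {0<..1} x *\<^sub>R mellin_kernel s x - I (s - 1) x + I s x / 2"
    proof -
      have "complex_of_real x powr (s - 1) = of_real x powr (s - 2) * of_real x powr 1"
        unfolding powr_add[symmetric] by simp
      hence eq: "complex_of_real x powr (s - 1) = of_real x powr (s - 2) * of_real x"
        using True by simp
      have eq2: "s - 1 - 1 = s - 2" by simp
      show ?thesis using True unfolding mellin_kernel_def I_def eq eq2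
        by (simp add: algebra_simps)
    qed
    ultimately show ?thesis by (simp add: sums_iff)
  qed (simp add: f_def I_def)
  have split: "integrable lborel (\<lambda>x. indicator {0<..1} x *\<^sub>R mellin_kernel s x)"
    using set_integrable_subset[OF mellin_kernel_integral(1)[OF s], of "{0<..1}"]
    by (simp add: set_integrable_def subset_eq)
  have "(\<lambda>m. integral\<^sup>L lborel (f m)) sums
     (\<integral>x. indicator {0<..1} x *\<^sub>R mellin_kernel s x - I (s - 1) x + I s x / 2 \<partial>lborel)"
    using sums_integral[OF *] unfolding sum_f .
  moreover have "integral\<^sup>L lborel (f m) = of_real (bern_coeff m) / (s + of_nat (2 * m + 1))" for m
    unfolding f_def using I_int[OF Re_pos[of m]] by simp
  moreover have "(\<integral>x. indicator {0<..1} x *\<^sub>R mellin_kernel s x - I (s - 1) x + I s x / 2 \<partial>lborel)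
      = (LINT x:{0<..1}|lborel. mellin_kernel s x) - 1 / (s - 1) + 1 / (2 * s)"
    using s split I_int[of s] I_int[of "s - 1"] by (simp add: set_lebesgue_integral_def)
  ultimately show ?thesis by simp
qed

section \<open>The integral over \<open>x > 1\<close> as an entire function\<close>

text \<open>For \<open>x > 1\<close> the kernel grows in modulus with \<open>Re s\<close>, so every
  \<open>s\<close> is dominated by a real exponent \<open>R \<ge> 2\<close>, for which integrability
  is known.\<close>

lemma mellin_kernel_integrable_greaterThan_1:
  "set_integrable lborel {1<..} (mellin_kernel s)"
proof -
  define R where "R = max 2 (Re s)"
  have "set_integrable lborel {1<..} (mellin_kernel (of_real R))"
    by (rule set_integrable_subset[OF mellin_kernel_integral(1)]) (auto simp: R_def)
  moreover have "set_borel_measurable lborel {1<..} (mellin_kernel s)"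
    by (rule set_borel_measurable_mellin_kernel) auto
  ultimately show ?thesis
  proof (rule set_integrable_bound)
    show "AE x in lborel. x \<in> {1<..} \<longrightarrow> norm (mellin_kernel s x) \<le> norm (mellin_kernel (of_real R) x)"
      by (intro AE_I2 impI) (auto simp: norm_mellin_kernel R_def intro!: divide_right_mono powr_mono)
  qed
qed

definition mellin_tail :: "complex \<Rightarrow> complex" where
  "mellin_tail s = (LINT x:{1<..}|lborel. mellin_kernel s x)"

text \<open>
  Writing \<open>x\<^bsup>s-1\<^esup> = x e\<^bsup>(s-2) ln x\<^esup>\<close> and integrating the exponential series termwise gives an everywhere
  convergent power series about \<open>s = 2\<close>.
\<close>

lemma holomorphic_mellin_tail: "mellin_tail holomorphic_on A"
proof -
  define f where "f = (\<lambda>w n x. indicator {1<..} x *\<^sub>R (w ^ n * of_real (ln x ^ n / fact n) * mellin_kernel 2 x))"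
  have f_meas: "f w n \<in> borel_measurable lborel" for w n
  proof -
    have "set_borel_measurable lborel {1<..} (mellin_kernel 2)"
      by (rule set_borel_measurable_mellin_kernel) auto
    hence [measurable]: "(\<lambda>x. indicator {1<..} x *\<^sub>R mellin_kernel 2 x) \<in> borel_measurable borel"
      by (simp add: set_borel_measurable_def)
    have "(\<lambda>x. w ^ n * of_real (ln x ^ n / fact n) * (indicator {1<..} x *\<^sub>R mellin_kernel 2 x)) \<in> borel_measurable borel"
      by measurable
    moreover have "f w n = (\<lambda>x. w ^ n * of_real (ln x ^ n / fact n) * (indicator {1<..} x *\<^sub>R mellin_kernel 2 x))"
      by (auto simp: f_def fun_eq_iff)
    ultimately show ?thesis by simp
  qed
  have f_sums: "(\<lambda>n. f w n x) sums (indicator {1<..} x *\<^sub>R mellin_kernel (2 + w) x)" for w x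
  proof (cases "x > 1")
    case True
    have "(\<lambda>n. (w * of_real (ln x)) ^ n /\<^sub>R fact n) sums exp (w * of_real (ln x))"
      by (rule exp_converges)
    hence "(\<lambda>n. (w * of_real (ln x)) ^ n /\<^sub>R fact n * mellin_kernel 2 x) sums
        (exp (w * of_real (ln x)) * mellin_kernel 2 x)"
      by (rule sums_mult2)
    moreover have "exp (w * of_real (ln x)) * mellin_kernel 2 x = mellin_kernel (2 + w) x"
      using True by (simp add: mellin_kernel_def powr_def Ln_of_real exp_add[symmetric] algebra_simps)
    moreover have "(w * of_real (ln x)) ^ n /\<^sub>R fact n * mellin_kernel 2 x = f w n x" for n
      using True by (simp add: f_def power_mult_distrib scaleR_conv_of_real field_simps)
    ultimately show ?thesis using True by simp
  qed (simp add: f_def)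
  \<comment> \<open>Since \<open>ln x > 0\<close>, the norms are the terms for
    \<open>norm w\<close>. They sum to the integrable kernel at \<open>2 + norm w\<close>, which
    bounds every partial sum and so justifies termwise integration.\<close>
  have norm_f: "complex_of_real (norm (f w n x)) = f (of_real (norm w)) n x" for w n x
  proof (cases "x > 1")
    case True
    hence "complex_of_real (norm (mellin_kernel 2 x)) = mellin_kernel 2 x"
      unfolding mellin_kernel_def norm_divide norm_of_real by (simp add: norm_powr_real_powr)
    thus ?thesis using True by (simp add: f_def norm_mult norm_power norm_divide)
  qed (simp add: f_def)
  have norm_sums: "(\<lambda>n. norm (f w n x)) sums (indicator {1<..} x * norm (mellin_kernel (2 + of_real (norm w)) x))" for w x
  proof -
    have "(\<lambda>n. complex_of_real (norm (f w n x))) sums (indicator {1<..} x *\<^sub>R mellin_kernel (2 + of_real (norm w)) x)"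
      unfolding norm_f by (rule f_sums)
    hence "(\<lambda>n. Re (complex_of_real (norm (f w n x)))) sums Re (indicator {1<..} x *\<^sub>R mellin_kernel (2 + of_real (norm w)) x)"
      by (rule sums_Re)
    moreover have "Re (indicator {1<..} x *\<^sub>R mellin_kernel (2 + of_real (norm w)) x)
        = indicator {1<..} x * norm (mellin_kernel (2 + of_real (norm w)) x)"
    proof (cases "x > 1")
      case True
      have "mellin_kernel (2 + of_real (norm w)) x = of_real (x powr (1 + norm w) / (exp x - 1))"
        using True powr_of_real[of x "1 + norm w"] unfolding mellin_kernel_def of_real_divide by simp
      thus ?thesis using True norm_mellin_kernel[of x "2 + of_real (norm w)"] by simp
    qed simp
    ultimately show ?thesis by (simp only: Re_complex_of_real)
  qed
  have bound_int: "integrable lborel (\<lambda>x. indicator {1<..} x * norm (mellin_kernel s x))" for s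
    using integrable_norm[OF mellin_kernel_integrable_greaterThan_1[unfolded set_integrable_def, of s]]
    by simp
  have partial: "(\<Sum>n\<in>N. norm (f w n x)) \<le> indicator {1<..} x * norm (mellin_kernel (2 + of_real (norm w)) x)"
    if "finite N" for N w x
    using sum_le_suminf[of "\<lambda>n. norm (f w n x)" N] norm_sums[of w x] that by (simp add: sums_iff)
  have f_int: "integrable lborel (f w n)" for w n
    by (rule Bochner_Integration.integrable_bound[OF bound_int[of "2 + of_real (norm w)"] f_meas])
      (use partial[of "{n}" w] in \<open>auto intro!: AE_I2 simp: abs_mult\<close>)
  have "mellin_tail holomorphic_on ball 2 r" for r
  proof (rule power_series_holomorphic)
    fix s :: complex
    define w where "w = s - 2"
    have "summable (\<lambda>n. \<integral>x. norm (f w n x) \<partial>lborel)"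
    proof (rule summableI_nonneg_bounded)
      fix n
      have "(\<Sum>i<n. \<integral>x. norm (f w i x) \<partial>lborel) = (\<integral>x. (\<Sum>i<n. norm (f w i x)) \<partial>lborel)"
        by (intro Bochner_Integration.integral_sum[symmetric] integrable_norm f_int)
      also have "\<dots> \<le> (\<integral>x. indicator {1<..} x * norm (mellin_kernel (2 + of_real (norm w)) x) \<partial>lborel)"
        by (intro integral_mono bound_int Bochner_Integration.integrable_sum integrable_norm f_int partial) auto
      finally show "(\<Sum>i<n. \<integral>x. norm (f w i x) \<partial>lborel) \<le>
          (\<integral>x. indicator {1<..} x * norm (mellin_kernel (2 + of_real (norm w)) x) \<partial>lborel)" .
    qed simp
    moreover have "AE x in lborel. summable (\<lambda>n. norm (f w n x))"
      using norm_sums[of w] by (auto simp: sums_iff)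
    ultimately have "(\<lambda>n. integral\<^sup>L lborel (f w n)) sums (\<integral>x. (\<Sum>n. f w n x) \<partial>lborel)"
      by (intro sums_integral f_int)
    moreover have "(\<integral>x. (\<Sum>n. f w n x) \<partial>lborel) = mellin_tail s"
      using f_sums[of w] by (simp add: sums_iff mellin_tail_def set_lebesgue_integral_def w_def)
    moreover have "integral\<^sup>L lborel (f w n) = integral\<^sup>L lborel (f 1 n) * (s - 2) ^ n" for n
    proof -
      have "f w n = (\<lambda>x. f 1 n x * (s - 2) ^ n)"
        by (auto simp: f_def fun_eq_iff w_def)
      thus ?thesis by simp
    qed
    ultimately show "(\<lambda>n. integral\<^sup>L lborel (f 1 n) * (s - 2) ^ n) sums mellin_tail s" by simp
  qed
  moreover have "s \<in> ball 2 (dist 2 s + 1)" for s :: complex by simp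
  ultimately have "mellin_tail field_differentiable (at s)" for s
    by (meson holomorphic_on_open open_ball field_differentiable_def)
  thus ?thesis
    by (auto simp: holomorphic_on_def intro: field_differentiable_at_within)
qed

subsection \<open>Zeta at the negative integers\<close>

definition pole_sum :: "complex \<Rightarrow> complex" where
  "pole_sum s = (\<Sum>m. of_real (bern_coeff m) / (s + of_nat (2 * m + 1)))"

text \<open>For \<open>m \<ge> K\<close> the denominators have modulus at least 1 on the closed unit
  ball about \<open>z\<close>, so the tail converges uniformly there and is holomorphic. The bound
  \<open>norm z < K\<close> ensures that a pole at \<open>z\<close> itself is among the explicit
  terms.\<close>

lemma pole_sum_split:
  fixes z :: complex
  shows "\<exists>K g. norm z < real K \<and> g holomorphic_on ball z 1 \<and>
    (\<forall>s\<in>ball z 1. pole_sum s = (\<Sum>m<K. of_real (bern_coeff m) / (s + of_nat (2 * m + 1))) + g s)"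
proof -
  define K where "K = nat \<lceil>norm z\<rceil> + 1"
  define t where "t = (\<lambda>m s. complex_of_real (bern_coeff m) / (s + of_nat (2 * m + 1)))"
  define g where "g = (\<lambda>s. \<Sum>m. t (m + K) s)"
  have norm_ge: "norm (s + of_nat (2 * (m + K) + 1)) \<ge> 1" if "s \<in> cball z 1" for s m
  proof -
    have "norm s \<le> norm z + 1"
      using that norm_triangle_ineq[of z "s - z"] by (simp add: dist_norm norm_minus_commute)
    moreover have "norm z \<le> real K - 1" unfolding K_def by linarith
    moreover have "real (2 * (m + K) + 1) - norm s \<le> norm (s + of_nat (2 * (m + K) + 1))"
      using norm_diff_ineq[of "of_nat (2 * (m + K) + 1)" s] unfolding norm_of_nat by (simp add: add.commute)
    ultimately show ?thesis by simp
  qed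
  have norm_t: "norm (t (m + K) s) \<le> \<bar>bern_coeff (m + K)\<bar>" if "s \<in> cball z 1" for s m
    using frac_le[of "\<bar>bern_coeff (m + K)\<bar>" "\<bar>bern_coeff (m + K)\<bar>" 1, OF _ _ _ norm_ge[OF that]]
    by (simp add: t_def norm_divide)
  have summ: "summable (\<lambda>m. \<bar>bern_coeff (m + K)\<bar>)"
    using summable_bern_coeff by (subst summable_iff_shift)
  have lim: "uniform_limit (cball z 1) (\<lambda>n s. \<Sum>m<n. t (m + K) s) g sequentially"
    unfolding g_def by (rule Weierstrass_m_test[OF norm_t summ])
  have hol: "g holomorphic_on ball z 1"
  proof (rule holomorphic_uniform_sequence[OF open_ball])
    show "(\<lambda>s. \<Sum>m<n. t (m + K) s) holomorphic_on ball z 1" for n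
      proof -
    have "s + of_nat (2 * (m + K) + 1) \<noteq> 0" if "s \<in> ball z 1" for s m
    proof
      assume eq: "s + of_nat (2 * (m + K) + 1) = 0"
      show False using norm_ge[of s m] that unfolding eq by simp
    qed
    thus ?thesis unfolding t_def by (intro holomorphic_intros)
  qed
    fix x assume "x \<in> ball z 1"
    then obtain d where "d > 0" "cball x d \<subseteq> ball z 1"
      using open_ball open_contains_cball by blast
    moreover have "uniform_limit (cball x d) (\<lambda>n s. \<Sum>m<n. t (m + K) s) g sequentially"
      using lim by (rule uniform_limit_on_subset) (use calculation ball_subset_cball in blast)
    ultimately show "\<exists>d>0. cball x d \<subseteq> ball z 1 \<and> uniform_limit (cball x d) (\<lambda>n s. \<Sum>m<n. t (m + K) s) g sequentially"
      by blast
  qed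
  have eq: "pole_sum s = (\<Sum>m<K. t m s) + g s" if "s \<in> ball z 1" for s
  proof -
    have "summable (\<lambda>m. t (m + K) s)"
      by (rule summable_comparison_test[OF _ summ]) (use norm_t that in auto)
    hence "summable (\<lambda>m. t m s)" by (subst (asm) summable_iff_shift)
    moreover have "pole_sum s = (\<Sum>m. t m s)" by (simp only: pole_sum_def t_def)
    ultimately show ?thesis unfolding g_def
      using suminf_split_initial_segment[of "\<lambda>m. t m s" K] by (simp add: add.commute)
  qed
  show ?thesis
  proof (intro exI[of _ K] exI[of _ g] conjI ballI hol)
    show "norm z < real K" unfolding K_def by linarith
  qed (use eq in \<open>simp add: t_def\<close>)
qed

text \<open>
  At \<open>1\<close>, \<open>0\<close> and the negative odd integers a division by zero makes the value junk; only its
  limits there matter, through \<^const>\<open>remove_sings\<close>.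
\<close>

definition zeta_pre :: "complex \<Rightarrow> complex" where
  "zeta_pre s = rGamma s * (1 / (s - 1) - 1 / (2 * s) + pole_sum s + mellin_tail s)"

text \<open>A local form about an arbitrary point: finitely many explicit fractions and an analytic
  remainder that absorbs \<open>mellin_tail\<close>. Meromorphy, analyticity for
  \<open>Re s > 1\<close> and the values at negative integers are all read off from it.\<close>

lemma zeta_pre_split:
  fixes z :: complex
  shows "\<exists>K g. norm z < real K \<and> g analytic_on {z} \<and> (\<forall>\<^sub>F s in nhds z. zeta_pre s =
    rGamma s * (1 / (s - 1) - 1 / (2 * s) + (\<Sum>m<K. of_real (bern_coeff m) / (s + of_nat (2 * m + 1))) + g s))"
proof -
  obtain K g where K: "norm z < real K" and g: "g holomorphic_on ball z 1"
    "\<And>s. s \<in> ball z 1 \<Longrightarrow> pole_sum s = (\<Sum>m<K. of_real (bern_coeff m) / (s + of_nat (2 * m + 1))) + g s"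
    using pole_sum_split[of z] by blast
  have "(\<lambda>s. g s + mellin_tail s) analytic_on ball z 1"
    using g(1) holomorphic_mellin_tail by (intro analytic_on_add) (auto simp: analytic_on_open)
  hence "(\<lambda>s. g s + mellin_tail s) analytic_on {z}" by (rule analytic_on_subset) auto
  moreover have "\<forall>\<^sub>F s in nhds z. s \<in> ball z 1" by (intro eventually_nhds_in_open) auto
  hence "\<forall>\<^sub>F s in nhds z. zeta_pre s =
    rGamma s * (1 / (s - 1) - 1 / (2 * s) + (\<Sum>m<K. of_real (bern_coeff m) / (s + of_nat (2 * m + 1))) + (g s + mellin_tail s))"
    by eventually_elim (simp add: zeta_pre_def g(2) add.assoc)
  ultimately show ?thesis using K by (intro exI[of _ K] exI[of _ "\<lambda>s. g s + mellin_tail s"]) auto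
qed

lemma zeta_pre_meromorphic: "zeta_pre meromorphic_on UNIV"
proof -
  have "zeta_pre meromorphic_on {z}" for z
  proof -
    from zeta_pre_split[of z] obtain K g where g: "g analytic_on {z}" and ev: "\<forall>\<^sub>F s in nhds z. zeta_pre s =
      rGamma s * (1 / (s - 1) - 1 / (2 * s) + (\<Sum>m<K. of_real (bern_coeff m) / (s + of_nat (2 * m + 1))) + g s)"
      by blast
    have "(\<lambda>s. rGamma s * (1 / (s - 1) - 1 / (2 * s) +
      (\<Sum>m<K. of_real (bern_coeff m) / (s + of_nat (2 * m + 1))) + g s)) meromorphic_on {z}"
      by (intro meromorphic_intros analytic_on_imp_meromorphic_on g analytic_on_rGamma analytic_on_ident)
    moreover have "\<forall>\<^sub>F s in at z. rGamma s * (1 / (s - 1) - 1 / (2 * s) +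
      (\<Sum>m<K. of_real (bern_coeff m) / (s + of_nat (2 * m + 1))) + g s) = zeta_pre s"
      using ev unfolding eventually_at_filter by eventually_elim simp
    ultimately show ?thesis
      by (subst (asm) meromorphic_on_cong[where B = "{z}" and g = zeta_pre]) auto
  qed
  thus ?thesis using meromorphic_on_meromorphic_at by blast
qed

lemma zeta_pre_eq:
  assumes s: "Re s > 1"
  shows "(\<lambda>n. 1 / of_nat (Suc n) powr s) sums zeta_pre s"
proof -
  have "pole_sum s = (LINT x:{0<..1}|lborel. mellin_kernel s x) - 1 / (s - 1) + 1 / (2 * s)"
    using mellin_kernel_integral_unit_interval[OF s] by (simp add: pole_sum_def sums_iff)
  moreover have "(LINT x:{0<..}|lborel. mellin_kernel s x) =
      (LINT x:{0<..1}|lborel. mellin_kernel s x) + mellin_tail s"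
  proof -
    have "{0<..} = {0<..1} \<union> {1::real<..}" by auto
    moreover have "set_integrable lborel {0<..1} (mellin_kernel s)"
      by (rule set_integrable_subset[OF mellin_kernel_integral(1)[OF s]]) auto
    ultimately show ?thesis
      using set_integral_Un[of "{0<..1}" "{1<..}" lborel "mellin_kernel s"] mellin_kernel_integrable_greaterThan_1[of s]
      by (simp add: mellin_tail_def disjoint_iff)
  qed
  ultimately show ?thesis
    using mellin_kernel_integral(2)[OF s] by (simp add: zeta_pre_def)
qed

text \<open>For \<open>Re s > 1\<close> no denominator vanishes, so \<open>zeta_pre\<close> is
  analytic at \<open>s\<close>. There \<open>remove_sings\<close> changes nothing and the Dirichlet
  series keeps its value.\<close>

lemma is_zeta_continuation_zeta_pre: "is_zeta_continuation (remove_sings zeta_pre)"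
  unfolding is_zeta_continuation_def
proof (intro conjI allI impI)
  show "remove_sings zeta_pre nicely_meromorphic_on UNIV"
    by (rule remove_sings_nicely_meromorphic zeta_pre_meromorphic)+
  fix s :: complex assume s: "Re s > 1"
  obtain K g where g: "g analytic_on {s}" and ev: "\<forall>\<^sub>F w in nhds s. zeta_pre w =
      rGamma w * (1 / (w - 1) - 1 / (2 * w) + (\<Sum>m<K. of_real (bern_coeff m) / (w + of_nat (2 * m + 1))) + g w)"
    using zeta_pre_split[of s] by blast
  have "s + of_nat (2 * m + 1) \<noteq> 0" for m
    using s by (auto simp: complex_eq_iff)
  moreover have "s \<noteq> 1" "s \<noteq> 0" using s by auto
  ultimately have "(\<lambda>w. rGamma w * (1 / (w - 1) - 1 / (2 * w) +
      (\<Sum>m<K. of_real (bern_coeff m) / (w + of_nat (2 * m + 1))) + g w)) analytic_on {s}"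
    by (intro analytic_intros analytic_on_rGamma g) auto
  hence "zeta_pre analytic_on {s}"
    by (subst analytic_at_cong[OF ev refl])
  thus "(\<lambda>n. 1 / of_nat (Suc n) powr s) sums remove_sings zeta_pre s"
    using zeta_pre_eq[OF s] by simp
qed

lemma zeta_eq_zeta_pre: "zeta = remove_sings zeta_pre"
  by (rule zeta_eqI is_zeta_continuation_zeta_pre)+

section \<open>Limits at the negative integers\<close>

text \<open>The difference quotient of \<open>rGamma\<close> at its zero \<open>- n\<close>.\<close>

lemma rGamma_tendsto_at_nonpos_int:
  "((\<lambda>s. rGamma s / (s + of_nat n)) \<longlongrightarrow> (-1) ^ n * fact n) (at (- of_nat n :: complex))"
proof -
  have "((\<lambda>s. (rGamma s - rGamma (- of_nat n)) / (s - (- of_nat n))) \<longlongrightarrow> (-1) ^ n * fact n) (at (- of_nat n :: complex))"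
    using has_field_derivative_rGamma_nonpos_int[of n UNIV] unfolding has_field_derivative_iff .
  moreover have "rGamma (- of_nat n :: complex) = 0" by (simp add: rGamma_eq_zero_iff)
  ultimately show ?thesis by simp
qed

text \<open>As \<open>rGamma\<close> vanishes at \<open>- n\<close>, every part that is regular
  there drops out in the limit. Only the fraction with its pole at \<open>- n\<close> survives,
  contributing its residue times the derivative of \<open>rGamma\<close>; it exists exactly when
  \<open>n\<close> is odd.\<close>

lemma zeta_neg_int:
  assumes n: "n > 0"
  shows "zeta (- of_nat n) = (if odd n then - fact n * of_real (bern_coeff ((n - 1) div 2)) else 0)"
proof -
  define z where "z = (- of_nat n :: complex)"
  obtain K g where K: "norm z < real K" and g: "g analytic_on {z}" and ev: "\<forall>\<^sub>F s in nhds z. zeta_pre s =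
      rGamma s * (1 / (s - 1) - 1 / (2 * s) + (\<Sum>m<K. of_real (bern_coeff m) / (s + of_nat (2 * m + 1))) + g s)"
    using zeta_pre_split[of z] by blast
  \<comment> \<open>The limit at \<open>z\<close> of the \<open>m\<close>-th fraction multiplied by
    \<open>rGamma\<close>.\<close>
  define c where "c = (\<lambda>m. if 2 * m + 1 = n then - fact n * complex_of_real (bern_coeff m) else 0)"
  have z0: "z \<noteq> 0" "z - 1 \<noteq> 0" using n by (auto simp: z_def complex_eq_iff)
  have r0: "rGamma z = 0" by (simp add: z_def rGamma_eq_zero_iff)
  have rG: "(rGamma \<longlongrightarrow> 0) (at z)"
    using isCont_rGamma[where f = "\<lambda>x. x" and z = z] r0 by (simp add: isCont_def)
  have "(\<lambda>s. 1 / (s - 1) - 1 / (2 * s) + g s) analytic_on {z}"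
    using z0 by (intro analytic_intros g) auto
  hence "((\<lambda>s. 1 / (s - 1) - 1 / (2 * s) + g s) \<longlongrightarrow> (1 / (z - 1) - 1 / (2 * z) + g z)) (at z)"
    by (intro isContD analytic_at_imp_isCont)
  from tendsto_mult[OF rG this]
  have 1: "((\<lambda>s. rGamma s * (1 / (s - 1) - 1 / (2 * s) + g s)) \<longlongrightarrow> 0) (at z)" by simp
  have 2: "((\<lambda>s. rGamma s * (of_real (bern_coeff m) / (s + of_nat (2 * m + 1)))) \<longlongrightarrow> c m) (at z)" for m
  proof (cases "2 * m + 1 = n")
    case True
    have "((\<lambda>s. of_real (bern_coeff m) * (rGamma s / (s + of_nat n))) \<longlongrightarrow>
        of_real (bern_coeff m) * ((-1) ^ n * fact n)) (at z)"
      unfolding z_def by (intro tendsto_mult tendsto_const rGamma_tendsto_at_nonpos_int)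
    moreover have "(-1) ^ n = (-1 :: complex)" unfolding True[symmetric] by simp
    moreover have "c m = - fact n * of_real (bern_coeff m)" using True by (simp add: c_def)
    ultimately show ?thesis unfolding True by (simp add: mult_ac)
  next
    case False
    have "z + of_nat (2 * m + 1) \<noteq> 0"
      unfolding z_def using False by (metis add.commute add_uminus_conv_diff of_nat_eq_iff right_minus_eq)
    hence "(\<lambda>s. of_real (bern_coeff m) / (s + of_nat (2 * m + 1))) analytic_on {z}"
      by (intro analytic_intros) auto
    hence "((\<lambda>s. of_real (bern_coeff m) / (s + of_nat (2 * m + 1))) \<longlongrightarrow>
        of_real (bern_coeff m) / (z + of_nat (2 * m + 1))) (at z)"
      by (intro isContD analytic_at_imp_isCont)
    from tendsto_mult[OF rG this] show ?thesis using False by (simp add: c_def)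
  qed
  have "((\<lambda>s. rGamma s * (1 / (s - 1) - 1 / (2 * s) + g s) +
      (\<Sum>m<K. rGamma s * (of_real (bern_coeff m) / (s + of_nat (2 * m + 1))))) \<longlongrightarrow> 0 + (\<Sum>m<K. c m)) (at z)"
    by (intro tendsto_add tendsto_sum 1 2)
  moreover have "\<forall>\<^sub>F s in at z. rGamma s * (1 / (s - 1) - 1 / (2 * s) + g s) +
      (\<Sum>m<K. rGamma s * (of_real (bern_coeff m) / (s + of_nat (2 * m + 1)))) = zeta_pre s"
    using ev unfolding eventually_at_filter
    by eventually_elim (simp add: ring_distribs sum_distrib_left del: of_nat_add)
  ultimately have "zeta_pre \<midarrow>z\<rightarrow> 0 + (\<Sum>m<K. c m)"
    by (rule Lim_transform_eventually)
  hence "zeta_pre \<midarrow>z\<rightarrow> (\<Sum>m<K. c m)" by (simp only: add_0)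
  hence "zeta z = (\<Sum>m<K. c m)"
    unfolding zeta_eq_zeta_pre by (rule remove_sings_eqI)
  also have "(\<Sum>m<K. c m) = (if odd n then - fact n * of_real (bern_coeff ((n - 1) div 2)) else 0)"
  proof (cases "odd n")
    case True
    then obtain k where k: "n = 2 * k + 1" by (elim oddE)
    have "norm z = real n" unfolding z_def norm_minus_cancel norm_of_nat ..
    hence "k < K" using K k by simp
    have "(\<Sum>m<K. c m) = (\<Sum>m\<in>{k}. c m)"
      by (rule sum.mono_neutral_right) (use \<open>k < K\<close> in \<open>auto simp: c_def k\<close>)
    thus ?thesis using True by (simp add: c_def k)
  next
    case False
    hence "c m = 0" for m by (auto simp: c_def)
    thus ?thesis using False by simp
  qed
  finally show ?thesis by (simp add: z_def)
qed

text \<open>Only the modulus enters \<open>M_X\<close>; taking it removes the alternating sign in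
  \<open>bern_coeff\<close>.\<close>

lemma norm_zeta_neg_int:
  assumes "n > 0"
  shows "norm (zeta (- of_nat n)) = (if odd n then 2 * fact n * pseries (n + 1) / (2 * pi) ^ (n + 1) else 0)"
proof (cases "odd n")
  case True
  then obtain k where k: "n = 2 * k + 1" by (elim oddE)
  have "pseries (2 * k + 2) \<ge> 1" by (rule pseries_bounds) simp
  hence "\<bar>bern_coeff k\<bar> = 2 * pseries (n + 1) / (2 * pi) ^ (n + 1)"
    by (simp add: bern_coeff_def abs_mult power_abs k)
  moreover have "zeta (- of_nat n) = - fact n * of_real (bern_coeff k)"
    using zeta_neg_int[OF assms] True by (simp add: k)
  ultimately show ?thesis using True
    by (simp only: norm_mult norm_minus_cancel norm_fact norm_of_real not_False_eq_True if_True) (simp only: mult_ac times_divide_eq_right)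
qed (use zeta_neg_int[OF assms] in simp)

subsection \<open>Asymptotics of the sums and of the weights\<close>

lemma a_X_nonneg: "a_X X j \<ge> 0"
proof (cases X)
  case Lucas
  \<comment> \<open>The Lucas numbers increase only from index 1 on, as they begin 2, 1; hence the
    shift and the separate case \<open>j = 0\<close>.\<close>
  have "incseq (\<lambda>n. lucas (Suc n))"
  proof (rule incseq_SucI)
    show "lucas (Suc n) \<le> lucas (Suc (Suc n))" for n by simp
  qed
  hence "lucas (Suc m) \<le> lucas (Suc n)" if "m \<le> n" for m n
    using that by (auto dest: incseqD)
  from this[of "j - 1" "2 * j - 1"] have "lucas j \<le> lucas (2 * j)" by (cases "j = 0") auto
  thus ?thesis using Lucas by simp
qed simp

lemma fib_le_power_two: "fib n \<le> 2 ^ n"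
  by (induction n rule: fib.induct) auto

lemma lucas_le_power_two: "lucas n \<le> 2 * 2 ^ n"
  by (induction n rule: lucas.induct) auto

text \<open>Any exponential bound suffices here, since it only has to be beaten by the factorial in
  \<open>E_X\<close>.\<close>

lemma a_X_le: "a_X X j \<le> 2 * 4 ^ j"
proof (cases X)
  case Fibonacci
  have "real (fib j) \<le> 2 ^ j" "real (fib (2 * j)) \<le> 4 ^ j"
    using of_nat_mono[OF fib_le_power_two[of j], where 'a = real]
      of_nat_mono[OF fib_le_power_two[of "2 * j"], where 'a = real]
    by (simp_all add: power_mult)
  moreover have "(2::real) ^ j \<le> 4 ^ j" by (rule power_mono) auto
  ultimately have "real (fib j) + real (fib (2 * j)) \<le> 2 * 4 ^ j" by linarith
  thus ?thesis using Fibonacci by simp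
next
  case Lucas
  have "real (lucas (2 * j)) \<le> 2 * 4 ^ j"
    using of_nat_mono[OF lucas_le_power_two[of "2 * j"], where 'a = real] by (simp add: power_mult)
  thus ?thesis using Lucas by simp
qed

section \<open>Binet's formula and the size of the weights\<close>

definition alpha_conj :: real where "alpha_conj = (1 - sqrt 5) / 2"

lemma alpha_bounds: "3 / 2 < alpha" "alpha < 1.65" "\<bar>alpha_conj\<bar> \<le> 1"
proof -
  have "2 < sqrt 5" by (rule real_less_rsqrt) simp
  moreover have "sqrt 5 < 2.3" by (rule real_less_lsqrt) (simp_all add: power2_eq_square)
  ultimately show "3 / 2 < alpha" "alpha < 1.65" "\<bar>alpha_conj\<bar> \<le> 1" by (auto simp: alpha_def alpha_conj_def)
qed

lemma alpha_sq_bounds: "2 < alpha_sq" "alpha_sq < 2.75"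
proof -
  have "alpha_sq = alpha + 1" by (simp add: alpha_sq_def alpha_def power2_eq_square field_simps)
  thus "2 < alpha_sq" "alpha_sq < 2.75" using alpha_bounds by auto
qed

lemma lucas_closed_form: "real (lucas n) = alpha ^ n + alpha_conj ^ n"
proof (induction n rule: lucas.induct)
  case (3 n)
  have "alpha ^ Suc (Suc n) = alpha ^ Suc n + alpha ^ n" "alpha_conj ^ Suc (Suc n) = alpha_conj ^ Suc n + alpha_conj ^ n"
    by (simp_all add: alpha_def alpha_conj_def field_simps)
  with 3 show ?case by simp
qed (simp_all add: alpha_def alpha_conj_def field_simps)

lemma c_X_pos: "c_X X > 0"
  by (cases X) auto

text \<open>By Binet's formula the dominant part comes from index \<open>2 * j\<close>. Three terms
  remain, one in \<open>alpha ^ j\<close> and two powers of the conjugate root, each of modulus at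
  most \<open>alpha ^ j\<close>.\<close>

lemma a_X_asymp: "\<bar>a_X X j - c_X X * alpha_sq ^ j\<bar> \<le> 3 * alpha ^ j"
proof -
  have b: "\<bar>alpha_conj ^ k\<bar> \<le> 1" for k
    unfolding power_abs using alpha_bounds by (intro power_le_one) auto
  have a: "1 \<le> alpha ^ j" using alpha_bounds by (intro one_le_power) auto
  have r: "alpha ^ (2 * j) = alpha_sq ^ j" by (simp add: alpha_sq_def power_mult)
  show ?thesis
  proof (cases X)
    case Fibonacci
    have "real (fib n) = (alpha ^ n - alpha_conj ^ n) / sqrt 5" for n
      unfolding alpha_def alpha_conj_def by (rule fib_closed_form)
    hence "a_X X j = (alpha ^ j - alpha_conj ^ j) / sqrt 5 + (alpha_sq ^ j - alpha_conj ^ (2 * j)) / sqrt 5"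
      using Fibonacci unfolding r[symmetric] by simp
    hence "a_X X j - c_X X * alpha_sq ^ j = (alpha ^ j - alpha_conj ^ j - alpha_conj ^ (2 * j)) / sqrt 5"
      using Fibonacci by (simp add: diff_divide_distrib add_divide_distrib)
    also have "\<bar>\<dots>\<bar> \<le> (3 * alpha ^ j) / 1"
      unfolding abs_divide
    proof (intro frac_le)
      show "\<bar>alpha ^ j - alpha_conj ^ j - alpha_conj ^ (2 * j)\<bar> \<le> 3 * alpha ^ j"
        using b[of j] b[of "2 * j"] a by linarith
    qed (use a in auto)
    finally show ?thesis by simp
  next
    case Lucas
    hence eq: "a_X X j - c_X X * alpha_sq ^ j = alpha_conj ^ (2 * j) - alpha ^ j - alpha_conj ^ j"
      by (simp add: lucas_closed_form r)
    show ?thesis unfolding eq using b[of j] b[of "2 * j"] a by linarith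
  qed
qed

section \<open>The sums \<open>M_X\<close> compared with the series \<open>D_X\<close>\<close>

text \<open>Extended by zero to all indices, so that \<open>D_X\<close> becomes an ordinary series
  with initial segments and tails.\<close>

definition E_term :: "seq_kind \<Rightarrow> nat \<Rightarrow> real" where
  "E_term X j = (if 2 \<le> j \<and> even j then a_X X j * pi ^ j / fact j else 0)"

lemma E_term_nonneg: "E_term X j \<ge> 0"
  using a_X_nonneg by (simp add: E_term_def)

text \<open>The extra weight \<open>2 ^ j\<close> amounts to evaluating at \<open>2 pi\<close>
  instead of \<open>pi\<close>; this room makes the truncation errors of size
  \<open>2^(-N)\<close>.\<close>

lemma summable_E_term: "summable (\<lambda>j. E_term X j * 2 ^ j)"
proof (rule summable_comparison_test)
  have "E_term X j * 2 ^ j \<le> 2 * ((8 * pi) ^ j /\<^sub>R fact j)" for j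
  proof -
    have "a_X X j * (pi ^ j / fact j * 2 ^ j) \<le> 2 * 4 ^ j * (pi ^ j / fact j * 2 ^ j)"
      by (intro mult_right_mono a_X_le) simp
    also have "\<dots> = 2 * ((4 * pi * 2) ^ j /\<^sub>R fact j)"
      by (simp only: power_mult_distrib) (simp add: divide_inverse)
    finally show ?thesis by (simp add: E_term_def)
  qed
  thus "\<exists>N. \<forall>j\<ge>N. norm (E_term X j * 2 ^ j) \<le> 2 * ((8 * pi) ^ j /\<^sub>R fact j)"
    using E_term_nonneg by (auto simp: abs_mult)
qed (intro summable_mult summable_exp_generic)

lemma E_term_sums: "E_term X sums D_X X"
proof -
  have "norm (E_term X j) \<le> E_term X j * 2 ^ j" for j
    using mult_left_mono[of 1 "2 ^ j" "E_term X j"] E_term_nonneg[of X j] by simp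
  hence "summable (E_term X)"
    using summable_comparison_test[OF _ summable_E_term] by blast
  hence s: "E_term X sums suminf (E_term X)" by (rule summable_sums)
  hence "(E_term X has_sum suminf (E_term X)) UNIV"
    by (rule sums_nonneg_imp_has_sum) (rule E_term_nonneg)
  also have "(E_term X has_sum suminf (E_term X)) UNIV \<longleftrightarrow>
    ((\<lambda>j. a_X X j * pi ^ j / fact j) has_sum suminf (E_term X)) {j. 2 \<le> j \<and> even j}"
    by (rule has_sum_cong_neutral) (auto simp: E_term_def)
  finally have "D_X X = suminf (E_term X)" unfolding D_X_def E_X_def by (rule infsumI)
  with s show ?thesis by simp
qed

text \<open>The summand at \<open>j = 2\<close> is positive and none is negative. Positivity turns
  absolute errors into relative ones.\<close>

lemma D_X_pos: "D_X X > 0"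
proof -
  have "a_X X 2 = 4" by (cases X) (simp_all add: numeral_eq_Suc)
  hence "0 < E_term X 2" by (simp add: E_term_def)
  also have "\<dots> = sum (E_term X) {2}" by simp
  also have "\<dots> \<le> D_X X"
    using sum_le_suminf[of "E_term X" "{2}"] E_term_sums[of X] E_term_nonneg by (simp add: sums_iff)
  finally show ?thesis .
qed

text \<open>With \<open>n = N - j - 1\<close> the factorials combine to \<open>N! / j!\<close> and
  the powers of two cancel against \<open>(2 pi)^(n+1)\<close>. For odd \<open>j\<close> the number
  \<open>n\<close> is even, so \<open>- n\<close> is a trivial zero, matching
  \<open>E_term X j = 0\<close>.\<close>

lemma norm_t_X:
  assumes N: "even N" and j: "j \<in> {1..N - 2}"
  shows "cmod (t_X X N j) = fact N / pi ^ N * (E_term X j * pseries (N - j))"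
proof -
  define n where "n = N - j - 1"
  have n: "n > 0" "N = Suc (n + j)" using j by (auto simp: n_def)
  have z: "of_nat j + 1 - of_nat N = (- of_nat n :: complex)" unfolding n by simp
  have t: "cmod (t_X X N j) = real N * real ((N - 1) choose j) * a_X X j * 2 ^ n * norm (zeta (- of_nat n))"
    unfolding t_X_def z norm_mult norm_power norm_of_nat norm_of_real norm_numeral
    using a_X_nonneg[of X j] by (simp add: n(2))
  show ?thesis
  proof (cases "even j")
    case False
    hence "even n" using N unfolding n(2) by simp
    thus ?thesis using False unfolding t norm_zeta_neg_int[OF n(1)] by (simp add: E_term_def)
  next
    case True
    hence "odd n" using N unfolding n(2) by simp
    have j2: "2 \<le> j" using True j by (cases "j = 1") auto
    have binom: "real N * real ((N - 1) choose j) * fact n = fact N / fact j"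
      using binomial_fact[of j "N - 1", where 'a = real] n by simp
    have pw: "2 ^ n * 2 / (2 * pi) ^ (n + 1) = pi ^ j / pi ^ N"
      by (simp add: n(2) power_add power_mult_distrib)
    have nj: "N - j = n + 1" using n by simp
    \<comment> \<open>Groups the factors into the binomial identity and the identity between powers
      of \<open>2\<close> and \<open>pi\<close>.\<close>
    have rearrange: "x * y * a * u * (2 * v * p / w) = (x * y * v) * (u * 2 / w) * a * p" for x y a u v p w :: real
      by (simp add: mult_ac)
    have "cmod (t_X X N j) =
        real N * real ((N - 1) choose j) * a_X X j * 2 ^ n * (2 * fact n * pseries (n + 1) / (2 * pi) ^ (n + 1))"
      using \<open>odd n\<close> unfolding t norm_zeta_neg_int[OF n(1)] by (simp only: if_True not_False_eq_True)
    also have "\<dots> = (fact N / fact j) * (pi ^ j / pi ^ N) * a_X X j * pseries (n + 1)"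
      unfolding rearrange binom pw ..
    also have "\<dots> = fact N / pi ^ N * (E_term X j * pseries (N - j))"
      unfolding nj using True j2 by (simp add: E_term_def mult_ac)
    finally show ?thesis .
  qed
qed

lemma M_X_asymp:
  "\<exists>B. \<forall>N\<ge>4. even N \<longrightarrow> (\<exists>e. \<bar>e\<bar> \<le> B / 2 ^ N \<and> M_X X N = fact N / pi ^ N * (D_X X + e))"
proof -
  define W where "W = (\<Sum>j. E_term X j * 2 ^ j)"
  have partial: "(\<Sum>j\<in>A. E_term X j * 2 ^ j) \<le> W" if "finite A" for A
    unfolding W_def using E_term_nonneg by (intro sum_le_suminf summable_E_term that) auto
  have "\<exists>e. \<bar>e\<bar> \<le> (4 * pseries 2 * W + 2 * W) / 2 ^ N \<and> M_X X N = fact N / pi ^ N * (D_X X + e)"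
    if N: "N \<ge> 4" "even N" for N
  proof -
    \<comment> \<open>The error is \<open>e\<^sub>1 - e\<^sub>2\<close>: the first part comes from
      replacing zeta(N - j) by 1, the second is the tail of \<open>D_X\<close> that
      \<open>M_X\<close> does not contain.\<close>
    define e\<^sub>1 where "e\<^sub>1 = (\<Sum>j<N-1. E_term X j * (pseries (N - j) - 1))"
    define e\<^sub>2 where "e\<^sub>2 = (\<Sum>j. E_term X (j + (N - 1)))"
    have "(\<Sum>j=1..N-2. E_term X j * pseries (N - j)) = (\<Sum>j<N-1. E_term X j * pseries (N - j))"
      using N by (intro sum.mono_neutral_left) (auto simp: E_term_def)
    moreover have "M_X X N = (\<Sum>j=1..N-2. fact N / pi ^ N * (E_term X j * pseries (N - j)))"
      unfolding M_X_def by (intro sum.cong refl norm_t_X N)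
    ultimately have "M_X X N = fact N / pi ^ N * (\<Sum>j<N-1. E_term X j * pseries (N - j))"
      unfolding sum_distrib_left[symmetric] by simp
    moreover have "(\<Sum>j<N-1. E_term X j * pseries (N - j)) = D_X X + (e\<^sub>1 - e\<^sub>2)"
    proof -
      have "D_X X = e\<^sub>2 + (\<Sum>j<N-1. E_term X j)"
        using suminf_split_initial_segment[of "E_term X" "N - 1"] E_term_sums[of X]
        unfolding e\<^sub>2_def sums_iff by simp
      moreover have "e\<^sub>1 = (\<Sum>j<N-1. E_term X j * pseries (N - j)) - (\<Sum>j<N-1. E_term X j)"
        unfolding e\<^sub>1_def right_diff_distrib sum_subtractf by simp
      ultimately show ?thesis by simp
    qed
    moreover have "\<bar>e\<^sub>1 - e\<^sub>2\<bar> \<le> (4 * pseries 2 * W + 2 * W) / 2 ^ N"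
    proof -
      \<comment> \<open>Writing \<open>2^(-(N-j))\<close> as \<open>2^(-N) * 2^j\<close> moves the
        dependence on \<open>j\<close> into the weighted series bounded by \<open>W\<close>.\<close>
      have e1b: "E_term X j * (pseries (N - j) - 1) \<le> 4 * pseries 2 / 2 ^ N * (E_term X j * 2 ^ j)"
        if "j < N - 1" for j
      proof -
        have "(2::real) ^ N = 2 ^ (N - j) * 2 ^ j" using that by (simp flip: power_add)
        hence "4 * pseries 2 / 2 ^ (N - j) = 4 * pseries 2 / 2 ^ N * 2 ^ j" by simp
        hence "pseries (N - j) - 1 \<le> 4 * pseries 2 / 2 ^ N * 2 ^ j"
          using pseries_bounds(2)[of "N - j"] that by linarith
        from mult_left_mono[OF this E_term_nonneg[of X j]] show ?thesis by (simp only: mult_ac)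
      qed
      have "e\<^sub>1 \<le> 4 * pseries 2 / 2 ^ N * (\<Sum>j<N-1. E_term X j * 2 ^ j)"
        unfolding e\<^sub>1_def sum_distrib_left by (intro sum_mono e1b) simp
      also have "\<dots> \<le> 4 * pseries 2 / 2 ^ N * W"
        using pseries_bounds(1)[of 2] by (intro mult_left_mono partial) auto
      finally have e1: "e\<^sub>1 \<le> 4 * pseries 2 / 2 ^ N * W" .
      have e1': "e\<^sub>1 \<ge> 0"
        unfolding e\<^sub>1_def using E_term_nonneg pseries_bounds(1) by (intro sum_nonneg mult_nonneg_nonneg) auto
      have summ: "summable (\<lambda>j. E_term X (j + (N - 1)))"
        using E_term_sums[of X] by (subst summable_iff_shift) (simp add: sums_iff)
      have e2': "e\<^sub>2 \<ge> 0" unfolding e\<^sub>2_def by (intro suminf_nonneg summ E_term_nonneg)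
      have summ2: "summable (\<lambda>j. E_term X (j + (N - 1)) * 2 ^ (j + (N - 1)))"
        using summable_E_term[of X] summable_iff_shift[of "\<lambda>j. E_term X j * 2 ^ j" "N - 1"] by simp
      have pw: "(2::real) ^ N = 2 * 2 ^ (N - 1)" using N by (cases N) auto
      \<comment> \<open>All indices in the tail are at least \<open>N - 1\<close>, so the weight is
        at least \<open>2^(N-1)\<close>; its reciprocal is the prefactor
        \<open>2 / 2^N\<close>.\<close>
      have "e\<^sub>2 \<le> (\<Sum>j. 2 / 2 ^ N * (E_term X (j + (N - 1)) * 2 ^ (j + (N - 1))))"
        unfolding e\<^sub>2_def
      proof (intro suminf_le summ summable_mult summ2)
        fix j
        have "E_term X (j + (N - 1)) * 1 \<le> E_term X (j + (N - 1)) * 2 ^ j"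
          by (intro mult_left_mono E_term_nonneg) simp
        thus "E_term X (j + (N - 1)) \<le> 2 / 2 ^ N * (E_term X (j + (N - 1)) * 2 ^ (j + (N - 1)))"
          by (simp add: pw power_add)
      qed
      also have "\<dots> = 2 / 2 ^ N * (\<Sum>j. E_term X (j + (N - 1)) * 2 ^ (j + (N - 1)))"
        by (rule suminf_mult[OF summ2])
      also have "(\<Sum>j. E_term X (j + (N - 1)) * 2 ^ (j + (N - 1))) \<le> W"
        using suminf_split_initial_segment[OF summable_E_term, of X "N - 1"] E_term_nonneg[of X]
        by (simp add: W_def sum_nonneg)
      finally have "e\<^sub>2 \<le> 2 / 2 ^ N * W" by (simp add: divide_right_mono)
      with e1 e1' e2' show ?thesis
        by (simp add: add_divide_distrib abs_le_iff)
    qed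
    ultimately show ?thesis by auto
  qed
  thus ?thesis by blast
qed

section \<open>The size of the denominators \<open>C_X\<close>\<close>

text \<open>The dominant parts of the two weights combine to \<open>c (r^N - N r^(N-1)) / 2\<close>.
  The rest is of order \<open>N alpha^N\<close>, and \<open>r = alpha^2\<close> makes the quotient
  of order \<open>alpha^(-N)\<close>.\<close>

lemma C_X_asymp:
  "\<exists>A. \<forall>N\<ge>4. \<exists>d. \<bar>d\<bar> \<le> A / alpha ^ N \<and>
     C_X X N = - (c_X X * alpha_sq ^ N * (real N - alpha_sq) / (2 * alpha_sq)) * (1 + d)"
proof -
  \<comment> \<open>The 15 is 3 from the bound on the weights times 5 from
    \<open>N + 1 \<le> 5 (N - r)\<close>, which holds from \<open>N = 4\<close> on since
    \<open>r < 2.75\<close>.\<close>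
  define A where "A = 15 * alpha_sq / c_X X"
  have "\<exists>d. \<bar>d\<bar> \<le> A / alpha ^ N \<and>
     C_X X N = - (c_X X * alpha_sq ^ N * (real N - alpha_sq) / (2 * alpha_sq)) * (1 + d)"
    if N: "N \<ge> 4" for N
  proof -
    define L where "L = c_X X * alpha_sq ^ N * (real N - alpha_sq) / (2 * alpha_sq)"
    define err where "err = (\<lambda>j. a_X X j - c_X X * alpha_sq ^ j)"
    have Nr: "real N - alpha_sq > 0" "real N + 1 \<le> 5 * (real N - alpha_sq)"
      using N alpha_sq_bounds by auto
    have pos: "alpha_sq > 0" "c_X X > 0" "alpha > 0" using alpha_sq_bounds c_X_pos alpha_bounds by auto
    have L: "L > 0" unfolding L_def using pos Nr by simp
    have "alpha_sq ^ N = alpha_sq * alpha_sq ^ (N - 1)" using N by (cases N) auto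
    hence CL: "C_X X N = - L + (err N - real N * err (N - 1)) / 2"
      using pos by (simp add: C_X_def L_def err_def field_simps)
    have "\<bar>err N\<bar> \<le> 3 * alpha ^ N" unfolding err_def by (rule a_X_asymp)
    moreover have "\<bar>err (N - 1)\<bar> \<le> 3 * alpha ^ N"
      unfolding err_def using alpha_bounds
      by (intro order.trans[OF a_X_asymp] mult_left_mono power_increasing) auto
    hence "\<bar>real N * err (N - 1)\<bar> \<le> real N * (3 * alpha ^ N)"
      unfolding abs_mult by (intro mult_mono) auto
    ultimately have E: "\<bar>err N - real N * err (N - 1)\<bar> \<le> 3 * alpha ^ N * (real N + 1)"
      by (simp add: algebra_simps abs_le_iff)
    also have "\<dots> \<le> 3 * alpha ^ N * (5 * (real N - alpha_sq))"
      using pos Nr by (intro mult_left_mono) auto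
    also have "\<dots> = 2 * L * (A / alpha ^ N)"
    proof -
      have sq: "alpha_sq ^ N = alpha ^ N * alpha ^ N"
        by (simp add: alpha_sq_def power2_eq_square power_mult_distrib)
      show ?thesis using pos unfolding L_def A_def sq by (simp add: field_simps)
    qed
    finally have "\<bar>err N - real N * err (N - 1)\<bar> \<le> 2 * L * (A / alpha ^ N)" .
    hence "\<bar>- (err N - real N * err (N - 1)) / (2 * L)\<bar> \<le> A / alpha ^ N"
      using L by (simp add: abs_divide divide_le_eq mult_ac)
    moreover have "C_X X N = - L * (1 + - (err N - real N * err (N - 1)) / (2 * L))"
      using L unfolding CL by (simp add: field_simps)
    ultimately show ?thesis unfolding L_def by blast
  qed
  thus ?thesis by blast
qed

section \<open>Relative errors of \<open>M_X\<close> and \<open>kappa_X\<close>\<close>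

theorem corollary8:
  fixes X :: seq_kind
  shows "sim_evens (M_X X) (\<lambda>N. fact N / pi ^ N * D_X X)
    \<and> sim_evens (kappa_X X) (\<lambda>N. 2 * alpha_sq * D_X X / c_X X * (fact (N - 1) / (pi * alpha_sq) ^ N))
    \<and> (\<exists>\<epsilon> :: nat \<Rightarrow> real. \<epsilon> \<in> O[evens_at_top](\<lambda>N. 1 / alpha ^ N) \<and>
         (\<forall>N\<ge>4. even N \<longrightarrow>
            kappa_X X N = 2 * alpha_sq * D_X X / c_X X * (fact N / ((real N - alpha_sq) * (pi * alpha_sq) ^ N)) * (1 + \<epsilon> N)))"
proof -
  obtain B where "\<forall>N\<ge>4. even N \<longrightarrow> (\<exists>e. \<bar>e\<bar> \<le> B / 2 ^ N \<and> M_X X N = fact N / pi ^ N * (D_X X + e))"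
    using M_X_asymp by blast
  then obtain e where e: "\<bar>e N\<bar> \<le> B / 2 ^ N" "M_X X N = fact N / pi ^ N * (D_X X + e N)"
    if "N \<ge> 4" "even N" for N
    by metis
  obtain A where "\<forall>N\<ge>4. \<exists>d. \<bar>d\<bar> \<le> A / alpha ^ N \<and>
     C_X X N = - (c_X X * alpha_sq ^ N * (real N - alpha_sq) / (2 * alpha_sq)) * (1 + d)"
    using C_X_asymp by blast
  then obtain d where d: "\<bar>d N\<bar> \<le> A / alpha ^ N"
    "C_X X N = - (c_X X * alpha_sq ^ N * (real N - alpha_sq) / (2 * alpha_sq)) * (1 + d N)"
    if "N \<ge> 4" for N
    by metis
  have pos: "alpha > 3 / 2" "alpha < 2" "alpha_sq > 2" "alpha_sq < 3" "c_X X > 0" "D_X X > 0"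
    using alpha_bounds alpha_sq_bounds c_X_pos D_X_pos by auto
  \<comment> \<open>The absolute value makes the formula for \<open>kappa_X\<close> exact for every
    even \<open>N \<ge> 4\<close>, even where \<open>d N\<close> is not yet small.\<close>
  define \<epsilon> where "\<epsilon> N = (1 + e N / D_X X) / \<bar>1 + d N\<bar> - 1" for N
  \<comment> \<open>The factor 2 bounds \<open>1 / (1 + d N)\<close> once
    \<open>\<bar>d N\<bar> < 1 / 2\<close>; the summands are the relative error of
    \<open>M_X\<close> and that of \<open>C_X\<close>.\<close>
  define K where "K = 2 * (\<bar>B\<bar> / D_X X + A)"
  have A0: "A \<ge> 0"
  proof -
    have "0 \<le> A / alpha ^ 4" using d(1)[of 4] by simp
    thus ?thesis using pos by (simp add: zero_le_divide_iff)
  qed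
  \<comment> \<open>Since \<open>alpha < 2\<close>, the error of \<open>M_X\<close> is absorbed into
    the rate of \<open>C_X\<close>.\<close>
  have e': "\<bar>e N\<bar> \<le> \<bar>B\<bar> / alpha ^ N" if "N \<ge> 4" "even N" for N
  proof -
    have "\<bar>e N\<bar> \<le> \<bar>B\<bar> / 2 ^ N"
      using e(1)[OF that] by (rule order.trans) (simp add: divide_right_mono)
    also have "\<dots> \<le> \<bar>B\<bar> / alpha ^ N"
      using pos by (intro divide_left_mono power_mono) auto
    finally show ?thesis .
  qed
  have lim: "((\<lambda>N. c / alpha ^ N) \<longlongrightarrow> 0) sequentially" for c
    using pos by real_asymp
  have even: "\<forall>\<^sub>F N in evens_at_top. N \<ge> 4 \<and> even N"
    unfolding eventually_inf_principal by (rule eventually_mono[OF eventually_ge_at_top[of 4]]) auto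
  have small: "\<forall>\<^sub>F N in evens_at_top. A / alpha ^ N < 1 / 2"
    using order_tendstoD(2)[OF lim[of A], of "1 / 2"] by (auto intro: filter_leD[OF inf_le1])
  have eps: "\<bar>\<epsilon> N\<bar> \<le> K / alpha ^ N" if N: "N \<ge> 4" "even N" and s: "A / alpha ^ N < 1 / 2" for N
  proof -
    have d1: "1 + d N > 1 / 2" using d(1)[OF N(1)] s by linarith
    have "\<epsilon> N = (e N / D_X X - d N) / (1 + d N)"
      using d1 by (simp add: \<epsilon>_def field_simps)
    also have "\<bar>\<dots>\<bar> = \<bar>e N / D_X X - d N\<bar> / (1 + d N)"
      using d1 by simp
    also have "\<dots> \<le> \<bar>e N / D_X X - d N\<bar> / (1 / 2)"
      using d1 by (intro divide_left_mono) auto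
    also have "\<dots> \<le> 2 * (\<bar>e N\<bar> / D_X X + \<bar>d N\<bar>)"
      using pos abs_triangle_ineq4[of "e N / D_X X" "d N"] by (simp add: abs_divide)
    also have "\<dots> \<le> 2 * (\<bar>B\<bar> / alpha ^ N / D_X X + A / alpha ^ N)"
      using pos by (intro mult_left_mono add_mono divide_right_mono e' d N) auto
    also have "\<dots> = K / alpha ^ N"
      using pos by (simp add: K_def field_simps)
    finally show ?thesis .
  qed
  have eps_ev: "\<forall>\<^sub>F N in evens_at_top. norm (\<epsilon> N) \<le> K / alpha ^ N"
    using even small by eventually_elim (use eps in auto)
  have eps_lim: "(\<epsilon> \<longlongrightarrow> 0) evens_at_top"
    using eps_ev tendsto_mono[OF inf_le1 lim[of K]] by (rule Lim_null_comparison)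
  have kappa: "kappa_X X N = 2 * alpha_sq * D_X X / c_X X * (fact N / ((real N - alpha_sq) * (pi * alpha_sq) ^ N)) * (1 + \<epsilon> N)"
    if N: "N \<ge> 4" "even N" for N
  proof -
    have Nr: "real N - alpha_sq > 0" using N pos by auto
    \<comment> \<open>Because division by zero gives zero, this holds for all reals; in particular
      \<open>1 + d N\<close> may vanish.\<close>
    have rearrange: "x / p * (D * z) / (c * r * n / (2 * a) * y) = 2 * a * D / c * (x / (n * (p * r))) * (z / y)"
      for x p D z c r n a y :: real
      by (simp add: mult_ac)
    have "kappa_X X N = fact N / pi ^ N * (D_X X + e N) /
       (c_X X * alpha_sq ^ N * (real N - alpha_sq) / (2 * alpha_sq) * \<bar>1 + d N\<bar>)"
      unfolding kappa_X_def e(2)[OF N] d(2)[OF N(1)] abs_mult using pos Nr by (simp add: abs_mult)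
    also have "D_X X + e N = D_X X * (1 + e N / D_X X)" using pos by (simp add: field_simps)
    finally have "kappa_X X N = 2 * alpha_sq * D_X X / c_X X * (fact N / ((real N - alpha_sq) * (pi ^ N * alpha_sq ^ N)))
        * ((1 + e N / D_X X) / \<bar>1 + d N\<bar>)"
      unfolding rearrange .
    thus ?thesis by (simp only: \<epsilon>_def power_mult_distrib add_diff_cancel_left' diff_add_cancel add.commute[of 1 "_ - 1"])
  qed
  have M: "sim_evens (M_X X) (\<lambda>N. fact N / pi ^ N * D_X X)"
    unfolding sim_evens_def
  proof (rule Lim_transform_eventually)
    have "(e \<longlongrightarrow> 0) evens_at_top"
    proof (rule Lim_null_comparison)
      show "\<forall>\<^sub>F N in evens_at_top. norm (e N) \<le> \<bar>B\<bar> / alpha ^ N"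
        using even by eventually_elim (use e' in auto)
    qed (rule tendsto_mono[OF inf_le1 lim])
    thus "((\<lambda>N. 1 + e N / D_X X) \<longlongrightarrow> 1) evens_at_top"
      using pos by (auto intro!: tendsto_eq_intros)
    show "\<forall>\<^sub>F N in evens_at_top. 1 + e N / D_X X = M_X X N / (fact N / pi ^ N * D_X X)"
      using even by eventually_elim (use e(2) pos in \<open>simp add: field_simps\<close>)
  qed
  have "sim_evens (kappa_X X) (\<lambda>N. 2 * alpha_sq * D_X X / c_X X * (fact (N - 1) / (pi * alpha_sq) ^ N))"
    unfolding sim_evens_def
  proof (rule Lim_transform_eventually)
    \<comment> \<open>This quotient is what separates \<open>N! / (N - r)\<close> in the sharp
      formula from \<open>(N - 1)!\<close> in the asymptotic one.\<close>
    have "((\<lambda>N. real N / (real N - alpha_sq)) \<longlongrightarrow> 1) sequentially"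
      by real_asymp
    from tendsto_mono[OF inf_le1 this]
    have "((\<lambda>N. real N / (real N - alpha_sq)) \<longlongrightarrow> 1) evens_at_top" .
    from tendsto_mult[OF this tendsto_add[OF tendsto_const[of 1] eps_lim]]
    show "((\<lambda>N. real N / (real N - alpha_sq) * (1 + \<epsilon> N)) \<longlongrightarrow> 1) evens_at_top" by simp
    show "\<forall>\<^sub>F N in evens_at_top. real N / (real N - alpha_sq) * (1 + \<epsilon> N) =
        kappa_X X N / (2 * alpha_sq * D_X X / c_X X * (fact (N - 1) / (pi * alpha_sq) ^ N))"
      using even
    proof eventually_elim
      case (elim N)
      define u where "u = 2 * alpha_sq * D_X X / c_X X"
      define f where "f = (fact (N - 1) :: real)"
      define q where "q = (pi * alpha_sq) ^ N"
      have "u > 0" "f > 0" "q > 0" using pos by (auto simp: u_def f_def q_def)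
      moreover have "fact N = real N * f" using elim by (subst fact_reduce) (auto simp: f_def)
      ultimately show ?case
        using kappa[of N] elim unfolding u_def[symmetric] f_def[symmetric] q_def[symmetric] by simp
    qed
  qed
  moreover have "\<epsilon> \<in> O[evens_at_top](\<lambda>N. 1 / alpha ^ N)"
  proof (rule bigoI)
    show "\<forall>\<^sub>F N in evens_at_top. norm (\<epsilon> N) \<le> K * norm (1 / alpha ^ N)"
      using eps_ev by eventually_elim (use pos in simp)
  qed
  ultimately show ?thesis using M kappa by blast
qed

end
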